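(* Suppose that $\overline H(\Omega,\lambda,T,\mu)=\int_\Omega H(\mu^\omega)\,d\lambda(\omega)<\infty$. Then the asymptotic entropy $\overline h(\Omega,\lambda,T,\mu)$ equals $0$ if and only if the tail boundary of $\mathrm{RWTDI}(\omega)$ is trivial for $\lambda$-a.e. $\omega\in\Omega$.
   Context: $G$ is a countable group, $\mathcal P G$ is the set of probability measures on $G$, products of measures are convolutions. $(\Omega,\lambda)$ is a Lebesgue probability space with an invertible ergodic measure preserving transformation $T$, and $\omega\mapsto\mu^\omega\in\mathcal P G$ is a measurable map. For $0\le k\le n$ put $\mu^\omega_{k,n}=\mu^{T^k\omega}\mu^{T^{k+1}\omega}\cdots\mu^{T^n\omega}$ (convolution). For $\omega\in\Omega$, $\mathrm{RWTDI}(\omega)$ (random walk with time dependent increments) is the Markov chain on $G$ with transition probabilities at time $n$ given by $\mathrm{Prob}(x_{n+1}=gh\mid x_n=g)=\mu^{T^n\omega}(h)$. The family of these chains is the random walk with random transition probabilities $\mathrm{RWRTP}(\Omega,\lambda,T,\mu)$. $\mathbf P_\omega$ is the measure on the path space $G^{\mathbb Z_+}=\{(x_0,x_1,\dots)\}$ of $\mathrm{RWTDI}(\omega)$ started from $x_0=e$. The tail boundary of $\mathrm{RWTDI}(\omega)$ is the quotient of the Lebesgue space $(G^{\mathbb Z_+},\mathbf P_\omega)$ by the completed tail $\sigma$-algebra $\bigcap_n\sigma(x_n,x_{n+1},\dots)$; it is trivial if it is a singleton mod 0, i.e., if every tail event has $\mathbf P_\omega$-measure $0$ or $1$. $H(p)=-\sum_i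 p_i\log p_i$ is the entropy of a discrete probability distribution. When $\overline H(\Omega,\lambda,T,\mu)<\infty$, the asymptotic entropy is the limit $\overline h(\Omega,\lambda,T,\mu)=\lim_{n\to\infty}\frac1n H(\mu^\omega_{0,n-1})$, which exists for $\lambda$-a.e. $\omega$ and in $L^1(\Omega,\lambda)$ and is a.e. independent of $\omega$. *)

theory Defs
  imports "HOL-Probability.Probability"
begin

text \<open>
  The countable group \<open>G\<close> is a type of class \<open>{group_add, countable}\<close>. The class \<open>group_add\<close> is
  not assumed commutative; the group law \<open>gh\<close> is written \<open>g + h\<close> and the identity \<open>e\<close> is \<open>0\<close>.
  Probability measures on \<open>G\<close> have type \<open>'g pmf\<close>.
\<close>

section \<open>Lebesgue spaces and ergodic automorphisms\<close>

text \<open>Rokhlin's model: Lebesgue measure on the interval \<open>[0, c]\<close> (empty or null if \<open>c \<le> 0\<close>)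
  together with countably many atoms of mass \<open>p n\<close>, placed at the points \<open>- 1 - n\<close> off the
  interval; masses \<open>p n = 0\<close> account for finitely many atoms.\<close>

definition interval_with_atoms :: "real measure \<Rightarrow> bool" where
  "interval_with_atoms N \<longleftrightarrow>
     sets N = sets borel \<and>
     (\<exists>(c::real) (p :: nat \<Rightarrow> ennreal). \<forall>A\<in>sets borel.
        emeasure N A = emeasure lborel (A \<inter> {0..c}) + (\<Sum>n. p n * indicator A (- 1 - real n)))"

definition isomorphic_mod0 :: "'a measure \<Rightarrow> 'b measure \<Rightarrow> bool" where
  "isomorphic_mod0 M N \<longleftrightarrow>
     (\<exists>A\<in>null_sets M. \<exists>B\<in>null_sets N. \<exists>f.
        let M' = restrict_space M (space M - A); N' = restrict_space N (space N - B) in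
          bij_betw f (space M') (space N') \<and>
          f \<in> M' \<rightarrow>\<^sub>M N' \<and> inv_into (space M') f \<in> N' \<rightarrow>\<^sub>M M' \<and>
          distr M' N' f = N')"

definition lebesgue_prob_space :: "'a measure \<Rightarrow> bool" where
  "lebesgue_prob_space M \<longleftrightarrow>
     prob_space M \<and> complete_measure M \<and>
     (\<exists>N. interval_with_atoms N \<and> isomorphic_mod0 M (completion N))"

definition invertible_measure_preserving :: "'a measure \<Rightarrow> ('a \<Rightarrow> 'a) \<Rightarrow> bool" where
  "invertible_measure_preserving M T \<longleftrightarrow>
     bij_betw T (space M) (space M) \<and>
     T \<in> M \<rightarrow>\<^sub>M M \<and> inv_into (space M) T \<in> M \<rightarrow>\<^sub>M M \<and>
     distr M M T = M"

definition ergodic :: "'a measure \<Rightarrow> ('a \<Rightarrow> 'a) \<Rightarrow> bool" where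
  "ergodic M T \<longleftrightarrow>
     (\<forall>A\<in>sets M. T -` A \<inter> space M = A \<longrightarrow> measure M A = 0 \<or> measure M A = 1)"

section \<open>Convolutions and entropy\<close>

definition conv_pmf :: "'g::group_add pmf \<Rightarrow> 'g pmf \<Rightarrow> 'g pmf" where
  "conv_pmf p q = map_pmf (\<lambda>(g, h). g + h) (pair_pmf p q)"

text \<open>The product \<open>\<mu>\<^bsub>k,n\<^esub>\<^sup>\<omega>\<close>, both end points included; meant for \<open>k \<le> n\<close>.\<close>

definition conv_segment :: "('w \<Rightarrow> 'w) \<Rightarrow> ('w \<Rightarrow> 'g::group_add pmf) \<Rightarrow> nat \<Rightarrow> nat \<Rightarrow> 'w \<Rightarrow> 'g pmf" where
  "conv_segment T \<mu> k n \<omega> =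
     foldr conv_pmf (map (\<lambda>i. \<mu> ((T ^^ i) \<omega>)) [k..<Suc n]) (return_pmf 0)"

text \<open>Shannon entropy, possibly infinite; \<open>0 * ln 0 = 0\<close>.\<close>

definition entropy_pmf :: "'g pmf \<Rightarrow> ennreal" where
  "entropy_pmf p = (\<integral>\<^sup>+ g. ennreal (- pmf p g * ln (pmf p g)) \<partial>count_space UNIV)"

definition mean_entropy :: "'w measure \<Rightarrow> ('w \<Rightarrow> 'g pmf) \<Rightarrow> ennreal" where
  "mean_entropy M \<mu> = (\<integral>\<^sup>+ \<omega>. entropy_pmf (\<mu> \<omega>) \<partial>M)"

text \<open>The constant which is the almost sure limit of \<open>H(\<mu>\<^bsub>0,n-1\<^esub>\<^sup>\<omega>) / n\<close>.\<close>

definition asymptotic_entropy ::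
    "'w measure \<Rightarrow> ('w \<Rightarrow> 'w) \<Rightarrow> ('w \<Rightarrow> 'g::group_add pmf) \<Rightarrow> ennreal" where
  "asymptotic_entropy M T \<mu> =
     (THE h. AE \<omega> in M.
        (\<lambda>n. entropy_pmf (conv_segment T \<mu> 0 (n - 1) \<omega>) / of_nat n) \<longlonglongrightarrow> h)"

lemma asymptotic_entropy_eqI:
  assumes "prob_space M"
    and "AE \<omega> in M. (\<lambda>n. entropy_pmf (conv_segment T \<mu> 0 (n - 1) \<omega>) / of_nat n) \<longlonglongrightarrow> h"
  shows "asymptotic_entropy M T \<mu> = h"
  unfolding asymptotic_entropy_def
proof (rule the_equality)
  interpret prob_space M by fact
  fix h' assume "AE \<omega> in M. (\<lambda>n. entropy_pmf (conv_segment T \<mu> 0 (n - 1) \<omega>) / of_nat n) \<longlonglongrightarrow> h'"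
  with assms(2) have "AE \<omega> in M. h' = h"
    by eventually_elim (rule LIMSEQ_unique)
  then show "h' = h" by simp
qed (fact assms(2))

section \<open>Path measures of time-inhomogeneous Markov chains\<close>

text \<open>\<open>K n g\<close> is the conditional law of \<open>x\<^bsub>n+1\<^esub>\<close> given \<open>x\<^sub>n = g\<close>. The path measure is the
  Ionescu-Tulcea measure: the kernel with index \<open>0\<close> is the initial law, and the kernel with
  index \<open>n + 1\<close>, which may look at \<open>x\<^sub>0, \<dots>, x\<^sub>n\<close>, only uses \<open>x\<^sub>n\<close>.\<close>

definition chain_kernel :: "'g \<Rightarrow> (nat \<Rightarrow> 'g \<Rightarrow> 'g pmf) \<Rightarrow> nat \<Rightarrow> (nat \<Rightarrow> 'g) \<Rightarrow> 'g measure" where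
  "chain_kernel x0 K n x =
     measure_pmf (case n of 0 \<Rightarrow> return_pmf x0 | Suc m \<Rightarrow> K m (x m))"

definition chain_path_measure :: "'g \<Rightarrow> (nat \<Rightarrow> 'g \<Rightarrow> 'g pmf) \<Rightarrow> (nat \<Rightarrow> 'g) measure" where
  "chain_path_measure x0 K =
     projective_family.lim UNIV
       (Ionescu_Tulcea.CI (chain_kernel x0 K) (\<lambda>_. count_space UNIV)) (\<lambda>_. count_space UNIV)"

lemma Ionescu_Tulcea_chain_kernel:
  fixes K :: "nat \<Rightarrow> 'g::countable \<Rightarrow> 'g pmf"
  shows "Ionescu_Tulcea (chain_kernel x0 K) (\<lambda>_. count_space UNIV)"
proof (rule Ionescu_Tulcea.intro)
  fix n :: nat
  show "chain_kernel x0 K n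
      \<in> PiM {0..<n} (\<lambda>_. count_space UNIV) \<rightarrow>\<^sub>M subprob_algebra (count_space UNIV)"
  proof (cases n)
    case 0
    then have "chain_kernel x0 K n = (\<lambda>_. measure_pmf (return_pmf x0))"
      by (simp add: chain_kernel_def fun_eq_iff)
    moreover have "measure_pmf (return_pmf x0) \<in> space (subprob_algebra (count_space UNIV))"
      by (rule measure_pmf_in_subprob_space)
    ultimately show ?thesis
      by (simp only: measurable_const)
  next
    case (Suc m)
    have "(\<lambda>x. x m) \<in> PiM {0..<n} (\<lambda>_. count_space UNIV) \<rightarrow>\<^sub>M count_space (UNIV :: 'g set)"
      using Suc by (intro measurable_component_singleton) simp
    then have "(\<lambda>x. measure_pmf (K m (x m)))
        \<in> PiM {0..<n} (\<lambda>_. count_space UNIV) \<rightarrow>\<^sub>M subprob_algebra (count_space UNIV)"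
      by (rule measurable_compose) (simp add: measure_pmf_in_subprob_space)
    moreover have "chain_kernel x0 K n = (\<lambda>x. measure_pmf (K m (x m)))"
      using Suc by (simp add: chain_kernel_def fun_eq_iff)
    ultimately show ?thesis
      by (simp only:)
  qed
qed (simp only: chain_kernel_def measure_pmf.prob_space_axioms)

section \<open>The random walk with random transition probabilities\<close>

definition rwtdi_transition ::
    "('w \<Rightarrow> 'w) \<Rightarrow> ('w \<Rightarrow> 'g::group_add pmf) \<Rightarrow> 'w \<Rightarrow> nat \<Rightarrow> 'g \<Rightarrow> 'g pmf" where
  "rwtdi_transition T \<mu> \<omega> n g = map_pmf (\<lambda>h. g + h) (\<mu> ((T ^^ n) \<omega>))"

definition rwtdi_measure ::
    "('w \<Rightarrow> 'w) \<Rightarrow> ('w \<Rightarrow> 'g::group_add pmf) \<Rightarrow> 'w \<Rightarrow> (nat \<Rightarrow> 'g) measure" where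
  "rwtdi_measure T \<mu> \<omega> = chain_path_measure 0 (rwtdi_transition T \<mu> \<omega>)"

text \<open>Completing the tail \<open>\<sigma>\<close>-algebra only changes its members by null sets, so triviality of the
  quotient is tested on the tail events themselves.\<close>

definition trivial_tail_boundary ::
    "('w \<Rightarrow> 'w) \<Rightarrow> ('w \<Rightarrow> 'g::group_add pmf) \<Rightarrow> 'w \<Rightarrow> bool" where
  "trivial_tail_boundary T \<mu> \<omega> \<longleftrightarrow>
     (\<forall>A\<in>prob_space.tail_events (rwtdi_measure T \<mu> \<omega>)
            (\<lambda>n. sets (vimage_algebra UNIV (\<lambda>x. x n) (count_space UNIV))).
        measure (rwtdi_measure T \<mu> \<omega>) A = 0 \<or> measure (rwtdi_measure T \<mu> \<omega>) A = 1)"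

end

theory Submission
  imports Defs
begin

text \<open>
  Write \<open>H(p)\<close> for Shannon entropy, \<open>\<mu>\<^sub>i = \<mu>(T\<^sup>i \<omega>)\<close> for the laws of the increments and
  \<open>H\<^sub>n(\<omega>) = H(\<mu>\<^sub>0 \<dots> \<mu>\<^sub>n\<^sub>-\<^sub>1)\<close> for the entropy of the position \<open>x\<^sub>n\<close>. Everything is governed by
  \<open>f\<^sub>n(\<omega>) = H\<^sub>n(\<omega>) - H\<^sub>n\<^sub>-\<^sub>1(T \<omega>)\<close>, which is the mutual information between \<open>x\<^sub>1\<close> and \<open>x\<^sub>n\<close>: given
  \<open>x\<^sub>1\<close>, the position \<open>x\<^sub>n\<close> is a translate of a product with entropy \<open>H\<^sub>n\<^sub>-\<^sub>1(T \<omega>)\<close>.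

  Strong subadditivity of entropy (\<open>shannon_submodular\<close>) makes \<open>f\<^sub>n\<close> decrease in \<open>n\<close>, to a limit
  \<open>f \<ge> 0\<close>. By telescoping, \<open>H\<^sub>n\<close> is the sum of \<open>f\<^sub>n\<^sub>-\<^sub>i(T\<^sup>i \<omega>)\<close> over \<open>i < n\<close>, so it lies between Birkhoff
  sums of \<open>f\<close> and of \<open>f\<^sub>N\<close>, up to a term of size \<open>o(n)\<close>. Birkhoff's theorem for these two functions
  (\<open>birkhoff_ergodic\<close>) then gives \<open>H\<^sub>n / n \<longlongrightarrow> \<integral> f\<close> almost surely (\<open>block_entropy_rate\<close>).
  Hence the asymptotic entropy is \<open>\<integral> f\<close>, and it vanishes iff \<open>f = 0\<close> almost everywhere.

  It remains to compare \<open>f\<close> with the tail of a single chain. If \<open>f\<close> vanishes along the orbit of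
  \<open>\<omega>\<close>, then for every \<open>k\<close> the mutual information of \<open>x\<^sub>k\<close> and \<open>x\<^sub>n\<close> tends to \<open>0\<close>, because it is a
  telescoping sum of \<open>k\<close> terms \<open>f\<^sub>n\<^sub>-\<^sub>i(T\<^sup>i \<omega>)\<close>. Small information means near independence, in a weak
  form of Pinsker's inequality (\<open>correlation_le_information\<close>). A tail event depends, by the Markov
  property, on the past only through \<open>x\<^sub>n\<close>, with \<open>n\<close> as large as we please; so it is independent of
  \<open>x\<^sub>k\<close>, then of \<open>x\<^sub>0, \<dots>, x\<^sub>k\<close>, and finally of itself
  (\<open>tail_trivial_if_information_vanishes\<close>).

  Conversely, the posterior probabilities \<open>P(x\<^sub>1 = g | x\<^sub>n)\<close> form a reverse martingale. If the tail is
  trivial its \<open>L\<^sup>2\<close> limit is constant, so the variances tend to \<open>0\<close>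
  (\<open>reverse_martingale_second_moment\<close>). The bound \<open>ln t \<le> t - 1\<close> estimates the information by these
  variances (\<open>information_le_conditional_variances\<close>), and therefore \<open>f(\<omega>) = 0\<close>.
\<close>

section \<open>Birkhoff's ergodic theorem\<close>

locale measure_preserving_map = prob_space M for M :: "'w measure" +
  fixes T :: "'w \<Rightarrow> 'w"
  assumes T_measurable [measurable]: "T \<in> M \<rightarrow>\<^sub>M M"
    and distr_T: "distr M M T = M"
begin

lemma T_power_measurable [measurable]: "(T ^^ n) \<in> M \<rightarrow>\<^sub>M M"
  by (induction n) (auto simp: id_def intro: measurable_comp[OF _ T_measurable])

lemma distr_T_power: "distr M M (T ^^ n) = M"
proof (induction n)
  case 0
  show ?case by (simp add: id_def)
next
  case (Suc n)
  have "distr M M (T ^^ Suc n) = distr (distr M M (T ^^ n)) M T"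
    by (simp add: distr_distr)
  also have "\<dots> = M" using Suc distr_T by simp
  finally show ?case .
qed

lemma AE_T_power:
  assumes "AE x in M. P x"
  shows "AE x in M. P ((T ^^ n) x)"
  by (rule AE_distrD[OF T_power_measurable[of n]]) (simp only: distr_T_power assms)

lemma AE_all_T_power:
  assumes "AE x in M. P x"
  shows "AE x in M. \<forall>n. P ((T ^^ n) x)"
  using AE_T_power[OF assms] by (simp add: AE_all_countable)

lemma integrable_T [intro]:
  fixes g :: "'w \<Rightarrow> real"
  assumes "integrable M g"
  shows "integrable M (\<lambda>x. g (T x))"
  by (rule integrable_distr[OF T_measurable]) (simp add: distr_T assms)

lemma integral_T:
  fixes g :: "'w \<Rightarrow> real"
  assumes [measurable]: "g \<in> borel_measurable M"
  shows "(\<integral>x. g (T x) \<partial>M) = (\<integral>x. g x \<partial>M)"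
  using integral_distr[OF T_measurable assms] by (simp add: distr_T)

definition birkhoff_sum :: "('w \<Rightarrow> real) \<Rightarrow> nat \<Rightarrow> 'w \<Rightarrow> real" where
  "birkhoff_sum g n x = (\<Sum>i<n. g ((T ^^ i) x))"

lemma birkhoff_sum_Suc_T: "birkhoff_sum g (Suc n) x = g x + birkhoff_sum g n (T x)"
  unfolding birkhoff_sum_def
  by (subst sum.lessThan_Suc_shift) (simp add: funpow_swap1)

lemma birkhoff_sum_measurable [measurable]:
  assumes [measurable]: "g \<in> borel_measurable M"
  shows "birkhoff_sum g n \<in> borel_measurable M"
  unfolding birkhoff_sum_def[abs_def] by measurable

text \<open>The maximum of the Birkhoff sums of lengths \<open>0, \<dots>, n\<close>. In this recursive form the cocycle
  identity, on which the maximal lemma rests, holds by definition.\<close>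

primrec birkhoff_max :: "('w \<Rightarrow> real) \<Rightarrow> nat \<Rightarrow> 'w \<Rightarrow> real" where
  "birkhoff_max g 0 = (\<lambda>x. 0)"
| "birkhoff_max g (Suc n) = (\<lambda>x. max 0 (g x + birkhoff_max g n (T x)))"

lemma birkhoff_max_nonneg: "0 \<le> birkhoff_max g n x"
  by (cases n) auto

lemma birkhoff_max_mono: "birkhoff_max g n x \<le> birkhoff_max g (Suc n) x"
proof (induction n arbitrary: x)
  case (Suc n)
  show ?case using Suc[of "T x"] by simp
qed simp

lemma birkhoff_sum_le_max: "birkhoff_sum g n x \<le> birkhoff_max g n x"
proof (induction n arbitrary: x)
  case 0
  show ?case by (simp add: birkhoff_sum_def)
next
  case (Suc n)
  show ?case using Suc[of "T x"] by (simp add: birkhoff_sum_Suc_T del: funpow.simps)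
qed

lemma birkhoff_max_integrable:
  assumes "integrable M g"
  shows "integrable M (birkhoff_max g n)"
proof (induction n)
  case (Suc n)
  then show ?case using assms by (auto intro!: integrable_max Bochner_Integration.integrable_add integrable_T)
qed simp

text \<open>Garsia's argument. Where the maximum \<open>m\<^sub>n\<close> of the first Birkhoff sums is positive, the
  recursion gives \<open>m\<^sub>n \<le> g + m\<^sub>n \<circ> T\<close>; elsewhere \<open>m\<^sub>n = 0 \<le> m\<^sub>n \<circ> T\<close>. As \<open>m\<^sub>n - m\<^sub>n \<circ> T\<close> has integral
  \<open>0\<close>, the integral of \<open>g\<close> over the set \<open>m\<^sub>n > 0\<close> is nonnegative, and these sets exhaust the space.\<close>

lemma maximal_ergodic_lemma:
  assumes g: "integrable M g"
    and pos: "AE x in M. \<exists>n. birkhoff_sum g n x > 0"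
  shows "0 \<le> (\<integral>x. g x \<partial>M)"
proof -
  have [measurable]: "g \<in> borel_measurable M" "\<And>n. birkhoff_max g n \<in> borel_measurable M"
    using g birkhoff_max_integrable[OF g] by auto
  define E where "E n = {x \<in> space M. birkhoff_max g n x > 0}" for n
  have E_meas [measurable]: "E n \<in> sets M" for n
    unfolding E_def by measurable
  have int_E: "integrable M (\<lambda>x. indicator (E n) x * g x)" for n
    using integrable_mult_indicator[OF E_meas g, of n] by simp
  have nonneg: "0 \<le> (\<integral>x. indicator (E n) x * g x \<partial>M)" for n
  proof -
    have "(\<integral>x. birkhoff_max g n x - birkhoff_max g n (T x) \<partial>M) \<le> (\<integral>x. indicator (E n) x * g x \<partial>M)"
    proof (rule integral_mono[OF _ int_E])
      show "integrable M (\<lambda>x. birkhoff_max g n x - birkhoff_max g n (T x))"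
        using birkhoff_max_integrable[OF g, of n] by auto
      fix x assume x: "x \<in> space M"
      show "birkhoff_max g n x - birkhoff_max g n (T x) \<le> indicator (E n) x * g x"
      proof (cases "birkhoff_max g n x > 0")
        case True
        then obtain m where m: "n = Suc m" by (cases n) auto
        have "birkhoff_max g n x = g x + birkhoff_max g m (T x)"
          using True by (auto simp: m max_def split: if_splits)
        also have "\<dots> \<le> g x + birkhoff_max g n (T x)"
          using birkhoff_max_mono[of g m "T x"] by (simp add: m)
        finally show ?thesis using True x by (simp add: E_def)
      next
        case False
        then show ?thesis using birkhoff_max_nonneg[of g n x] birkhoff_max_nonneg[of g n "T x"]
          by (simp add: E_def)
      qed
    qed
    moreover have "(\<integral>x. birkhoff_max g n x - birkhoff_max g n (T x) \<partial>M) = 0"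
      using birkhoff_max_integrable[OF g, of n] integral_T[of "birkhoff_max g n"]
      by (subst Bochner_Integration.integral_diff) auto
    ultimately show ?thesis by simp
  qed
  have "(\<lambda>n. \<integral>x. indicator (E n) x * g x \<partial>M) \<longlonglongrightarrow> (\<integral>x. g x \<partial>M)"
  proof (rule integral_dominated_convergence[where w="\<lambda>x. \<bar>g x\<bar>"])
    show "AE x in M. (\<lambda>n. indicator (E n) x * g x) \<longlonglongrightarrow> g x"
      using pos AE_space
    proof eventually_elim
      case (elim x)
      then obtain m where m: "birkhoff_sum g m x > 0" by blast
      have "x \<in> E n" if "n \<ge> m" for n
      proof -
        have "birkhoff_max g m x \<le> birkhoff_max g n x"
          using that birkhoff_max_mono by (rule lift_Suc_mono_le[of "\<lambda>n. birkhoff_max g n x", rotated])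
        then show ?thesis using m birkhoff_sum_le_max[of g m x] elim by (simp add: E_def)
      qed
      then have "eventually (\<lambda>n. indicator (E n) x * g x = g x) sequentially"
        by (auto simp: eventually_sequentially intro!: exI[of _ m])
      then show ?case by (rule tendsto_eventually)
    qed
    show "AE x in M. norm (indicator (E n) x * g x) \<le> \<bar>g x\<bar>" for n
      by (auto simp: indicator_def)
  qed (use g in auto)
  then show ?thesis
    by (rule LIMSEQ_le_const) (use nonneg in auto)
qed

end

locale ergodic_map = measure_preserving_map +
  assumes ergodic: "ergodic M T"
begin

text \<open>The set where the Birkhoff sums are unbounded above is strictly invariant, since passing from
  \<open>x\<close> to \<open>T x\<close> changes them by the fixed amount \<open>g x\<close> and an index shift. If it had measure \<open>1\<close>, the
  maximal lemma would contradict the sign of the integral, so by ergodicity it is null. Working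
  with boundedness instead of an upper limit of averages makes this invariance immediate.\<close>

lemma birkhoff_sum_bounded_above:
  assumes g: "integrable M g" and neg: "(\<integral>x. g x \<partial>M) < 0"
  shows "AE x in M. \<exists>B. \<forall>n. birkhoff_sum g n x \<le> B"
proof -
  have [measurable]: "g \<in> borel_measurable M" using g by auto
  define U where "U = {x \<in> space M. \<forall>k::nat. \<exists>n. birkhoff_sum g n x > real k}"
  have U_iff: "x \<in> U \<longleftrightarrow> (\<forall>B. \<exists>n. birkhoff_sum g n x > B)" if "x \<in> space M" for x
  proof
    assume "x \<in> U"
    then show "\<forall>B. \<exists>n. birkhoff_sum g n x > B"
      unfolding U_def using reals_Archimedean2 by (fastforce intro: less_trans)
  qed (use that in \<open>auto simp: U_def\<close>)
  have [measurable]: "U \<in> sets M" unfolding U_def by measurable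
  have T_space: "x \<in> space M \<Longrightarrow> T x \<in> space M" for x
    using T_measurable by (rule measurable_space)
  have "T x \<in> U \<longleftrightarrow> x \<in> U" if x: "x \<in> space M" for x
    unfolding U_iff[OF x] U_iff[OF T_space[OF x]]
  proof safe
    fix B assume *: "\<forall>B. \<exists>n. B < birkhoff_sum g n (T x)"
    then obtain n where "B - g x < birkhoff_sum g n (T x)" by blast
    then have "B < birkhoff_sum g (Suc n) x" by (simp add: birkhoff_sum_Suc_T)
    then show "\<exists>n. B < birkhoff_sum g n x" by blast
  next
    fix B assume *: "\<forall>B. \<exists>n. B < birkhoff_sum g n x"
    then obtain n where n: "max 0 (B + g x) < birkhoff_sum g n x" by blast
    then obtain m where "n = Suc m" by (cases n) (auto simp: birkhoff_sum_def)
    with n have "B < birkhoff_sum g m (T x)" by (simp add: birkhoff_sum_Suc_T)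
    then show "\<exists>n. B < birkhoff_sum g n (T x)" by blast
  qed
  then have "T -` U \<inter> space M = U"
    using T_space by (auto simp: U_def)
  with ergodic have "measure M U = 0 \<or> measure M U = 1"
    unfolding ergodic_def by auto
  moreover have "measure M U \<noteq> 1"
  proof
    assume "measure M U = 1"
    then have "AE x in M. x \<in> U" by (simp add: prob_eq_1)
    then have "AE x in M. \<exists>n. birkhoff_sum g n x > 0"
    proof eventually_elim
      case (elim x)
      then have "\<exists>n. real 0 < birkhoff_sum g n x" unfolding U_def by blast
      then show ?case by simp
    qed
    with maximal_ergodic_lemma[OF g] neg show False by simp
  qed
  ultimately have "AE x in M. x \<notin> U"
    by (subst AE_iff_measurable[of U]) (auto simp: emeasure_eq_measure U_def)
  then show ?thesis
    using AE_space by eventually_elim (auto simp: U_iff not_less)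
qed

text \<open>Subtracting slightly more than the mean from \<open>g\<close> makes the Birkhoff sums bounded above, and a
  bound divided by \<open>n\<close> disappears. Countably many margins \<open>1 / (k + 1)\<close> suffice.\<close>

lemma birkhoff_limsup_le:
  assumes g: "integrable M g"
  shows "AE x in M. \<forall>e>0. eventually (\<lambda>n. birkhoff_sum g n x / n \<le> (\<integral>x. g x \<partial>M) + e) sequentially"
proof -
  let ?I = "\<integral>x. g x \<partial>M"
  have "AE x in M. \<exists>B. \<forall>n. birkhoff_sum (\<lambda>x. g x - ?I - 1 / Suc k) n x \<le> B" for k :: nat
    by (rule birkhoff_sum_bounded_above) (use g in \<open>auto simp: prob_space\<close>)
  then have "AE x in M. \<forall>k::nat. \<exists>B. \<forall>n. birkhoff_sum (\<lambda>x. g x - ?I - 1 / Suc k) n x \<le> B"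
    by (simp add: AE_all_countable)
  then show ?thesis
  proof eventually_elim
    case (elim x)
    show ?case
    proof safe
      fix e :: real assume "e > 0"
      then obtain k where k: "1 / real (Suc k) < e / 2"
        using reals_Archimedean[of "e/2"] by (auto simp: inverse_eq_divide)
      obtain B where B: "\<And>n. birkhoff_sum (\<lambda>x. g x - ?I - 1 / Suc k) n x \<le> B"
        using elim by blast
      have "(\<lambda>n. B / real n) \<longlonglongrightarrow> 0"
        by (rule lim_const_over_n)
      then have "eventually (\<lambda>n. B / real n < e / 2) sequentially"
        by (rule order_tendstoD) (use \<open>e > 0\<close> in simp)
      then show "eventually (\<lambda>n. birkhoff_sum g n x / n \<le> ?I + e) sequentially"
        using eventually_gt_at_top[of 0]
      proof eventually_elim
        case (elim n)
        have "birkhoff_sum g n x - n * ?I - n * (1 / Suc k) = birkhoff_sum (\<lambda>x. g x - ?I - 1 / Suc k) n x"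
          by (simp add: birkhoff_sum_def sum_subtractf)
        also have "\<dots> \<le> B" by (rule B)
        finally have "birkhoff_sum g n x \<le> n * (?I + 1 / Suc k) + B"
          by (simp add: algebra_simps)
        then have "birkhoff_sum g n x / n \<le> (n * (?I + 1 / Suc k) + B) / n"
          by (rule divide_right_mono) simp
        also have "\<dots> = ?I + 1 / Suc k + B / n"
          using elim by (simp add: add_divide_distrib)
        finally show ?case using elim k by linarith
      qed
    qed
  qed
qed

theorem birkhoff_ergodic:
  assumes g: "integrable M g"
  shows "AE x in M. (\<lambda>n. birkhoff_sum g n x / n) \<longlonglongrightarrow> (\<integral>x. g x \<partial>M)"
proof -
  have "integrable M (\<lambda>x. - g x)" using g by simp
  from birkhoff_limsup_le[OF g] birkhoff_limsup_le[OF this] show ?thesis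
  proof eventually_elim
    case (elim x)
    have neg: "birkhoff_sum (\<lambda>x. - g x) n x = - birkhoff_sum g n x" for n
      by (simp add: birkhoff_sum_def sum_negf)
    show ?case
    proof (rule tendstoI)
      fix e :: real assume "e > 0"
      then have "eventually (\<lambda>n. birkhoff_sum g n x / n \<le> (\<integral>x. g x \<partial>M) + e/2) sequentially"
        "eventually (\<lambda>n. birkhoff_sum (\<lambda>x. - g x) n x / n \<le> (\<integral>x. - g x \<partial>M) + e/2) sequentially"
        using elim by (auto dest!: spec[of _ "e/2"])
      then show "eventually (\<lambda>n. dist (birkhoff_sum g n x / n) (\<integral>x. g x \<partial>M) < e) sequentially"
        by eventually_elim (use \<open>e > 0\<close> in \<open>auto simp: neg dist_real_def abs_if\<close>)
    qed
  qed
qed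

text \<open>The summand is the difference of two consecutive Birkhoff sums, whose averages have the same
  limit.\<close>

lemma orbit_growth_sublinear:
  assumes g: "integrable M g"
  shows "AE x in M. (\<lambda>n. g ((T ^^ n) x) / n) \<longlonglongrightarrow> 0"
  using birkhoff_ergodic[OF g]
proof eventually_elim
  case (elim x)
  let ?I = "\<integral>x. g x \<partial>M"
  have "(\<lambda>n. birkhoff_sum g (Suc n) x / Suc n * (Suc n / n) - birkhoff_sum g n x / n) \<longlonglongrightarrow> ?I * 1 - ?I"
    by (intro tendsto_diff tendsto_mult LIMSEQ_Suc[OF elim] elim LIMSEQ_Suc_n_over_n)
  moreover have "birkhoff_sum g (Suc n) x / Suc n * (Suc n / n) - birkhoff_sum g n x / n = g ((T ^^ n) x) / n" for n
  proof -
    have "birkhoff_sum g (Suc n) x / Suc n * (Suc n / n) = birkhoff_sum g (Suc n) x / n"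
      by (simp del: of_nat_Suc)
    then show ?thesis
      by (simp add: birkhoff_sum_def add_divide_distrib)
  qed
  ultimately show ?case by simp
qed

end

section \<open>Shannon entropy of discrete distributions\<close>

text \<open>Entropy as a real number, so that differences make sense. If the entropy is infinite the
  Bochner integral gives the junk value \<open>0\<close>, hence the finiteness assumptions below.\<close>

definition shannon :: "'a pmf \<Rightarrow> real" where
  "shannon p = (\<integral>x. - ln (pmf p x) \<partial>measure_pmf p)"

lemma entropy_pmf_eq_surprisal:
  "entropy_pmf p = (\<integral>\<^sup>+ x. ennreal (- ln (pmf p x)) \<partial>measure_pmf p)"
  unfolding entropy_pmf_def nn_integral_measure_pmf
  by (intro nn_integral_cong) (simp add: ennreal_mult'[symmetric])

lemma surprisal_nonneg: "0 \<le> - ln (pmf p x)"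
  using pmf_le_1[of p x] pmf_nonneg[of p x] by (cases "pmf p x = 0") (auto simp: ln_le_zero_iff less_le)

lemma integrable_surprisal:
  assumes "entropy_pmf p < top"
  shows "integrable (measure_pmf p) (\<lambda>x. ln (pmf p x))"
proof -
  have "integrable (measure_pmf p) (\<lambda>x. - ln (pmf p x))"
    by (rule integrableI_nonneg) (use assms in \<open>auto simp: entropy_pmf_eq_surprisal simp del: neg_0_le_iff_le
        intro!: AE_I2 surprisal_nonneg\<close>)
  then show ?thesis by simp
qed

lemma entropy_pmf_eq_shannon:
  assumes "entropy_pmf p < top"
  shows "entropy_pmf p = ennreal (shannon p)"
  unfolding shannon_def entropy_pmf_eq_surprisal
  by (rule nn_integral_eq_integral)
    (use integrable_surprisal[OF assms] surprisal_nonneg in \<open>auto simp del: neg_0_le_iff_le intro!: AE_I2\<close>)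

lemma shannon_nonneg: "0 \<le> shannon p"
  unfolding shannon_def by (rule integral_nonneg_AE) (rule AE_I2, rule surprisal_nonneg)

lemma shannon_eq_enn2real: "shannon p = enn2real (entropy_pmf p)"
  unfolding shannon_def entropy_pmf_eq_surprisal
  by (rule integral_eq_nn_integral) (auto simp del: neg_0_le_iff_le intro!: AE_I2 surprisal_nonneg)

lemma shannon_return [simp]: "shannon (return_pmf x) = 0"
  unfolding shannon_def by (subst integral_measure_pmf_real[of "{x}"]) auto

lemma entropy_return [simp]: "entropy_pmf (return_pmf x) = 0"
  unfolding entropy_pmf_eq_surprisal by (subst nn_integral_measure_pmf_finite) auto

lemma shannon_map:
  "shannon (map_pmf f p) = (\<integral>x. - ln (pmf (map_pmf f p) (f x)) \<partial>measure_pmf p)"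
  unfolding shannon_def by simp

lemma integrable_surprisal_map:
  assumes "entropy_pmf (map_pmf f p) < top"
  shows "integrable (measure_pmf p) (\<lambda>x. ln (pmf (map_pmf f p) (f x)))"
  using integrable_surprisal[OF assms] by simp

lemma pmf_map_ge: "pmf p x \<le> pmf (map_pmf f p) (f x)"
proof -
  have "measure (measure_pmf p) {x} \<le> measure (measure_pmf p) (f -` {f x})"
    by (rule measure_pmf.finite_measure_mono) auto
  then show ?thesis by (simp add: pmf_map measure_pmf_single)
qed

lemma entropy_map_le: "entropy_pmf (map_pmf f p) \<le> entropy_pmf p"
  unfolding entropy_pmf_eq_surprisal nn_integral_map_pmf
proof (rule nn_integral_mono_AE, rule AE_pmfI)
  fix x assume "x \<in> set_pmf p"
  then have "0 < pmf p x" by (simp add: pmf_positive)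
  then show "ennreal (- ln (pmf (map_pmf f p) (f x))) \<le> ennreal (- ln (pmf p x))"
    using pmf_map_ge[of p x f] by (intro ennreal_leI) simp
qed

lemma entropy_pair: "entropy_pmf (pair_pmf p q) = entropy_pmf p + entropy_pmf q"
proof -
  have "entropy_pmf (pair_pmf p q) =
      (\<integral>\<^sup>+ x. ennreal (- ln (pmf p (fst x))) + ennreal (- ln (pmf q (snd x))) \<partial>measure_pmf (pair_pmf p q))"
    unfolding entropy_pmf_eq_surprisal
  proof (rule nn_integral_cong_AE, rule AE_pmfI)
    fix x assume "x \<in> set_pmf (pair_pmf p q)"
    then have "0 < pmf p (fst x)" "0 < pmf q (snd x)" by (auto simp: pmf_positive)
    then show "ennreal (- ln (pmf (pair_pmf p q) x)) =
        ennreal (- ln (pmf p (fst x))) + ennreal (- ln (pmf q (snd x)))"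
      using surprisal_nonneg[of p "fst x"] surprisal_nonneg[of q "snd x"]
      by (cases x) (simp add: pmf_pair ln_mult flip: ennreal_plus)
  qed
  also have "\<dots> = (\<integral>\<^sup>+ x. ennreal (- ln (pmf p x)) \<partial>measure_pmf (map_pmf fst (pair_pmf p q))) +
      (\<integral>\<^sup>+ x. ennreal (- ln (pmf q x)) \<partial>measure_pmf (map_pmf snd (pair_pmf p q)))"
    unfolding nn_integral_map_pmf by (rule nn_integral_add) auto
  finally show ?thesis by (simp add: map_fst_pair_pmf map_snd_pair_pmf entropy_pmf_eq_surprisal)
qed

lemma shannon_map_inj: "inj f \<Longrightarrow> shannon (map_pmf f p) = shannon p"
  unfolding shannon_map by (simp add: pmf_map_inj' shannon_def)

lemma shannon_pair:
  assumes "entropy_pmf p < top" "entropy_pmf q < top"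
  shows "shannon (pair_pmf p q) = shannon p + shannon q"
proof -
  have fin: "entropy_pmf (pair_pmf p q) < top"
    using assms by (simp add: entropy_pair)
  have "ennreal (shannon (pair_pmf p q)) = ennreal (shannon p + shannon q)"
    using entropy_pair[of p q]
    unfolding entropy_pmf_eq_shannon[OF assms(1)] entropy_pmf_eq_shannon[OF assms(2)]
      entropy_pmf_eq_shannon[OF fin]
    by (simp add: shannon_nonneg)
  then show ?thesis by (simp add: shannon_nonneg del: ennreal_plus)
qed

text \<open>The one analytic inequality behind all entropy estimates here: \<open>ln t \<le> t - 1\<close>, integrated. In the
  applications \<open>t\<close> is a ratio of a subprobability density to the density of \<open>p\<close>.\<close>

lemma gibbs_inequality:
  assumes pos: "\<And>x. x \<in> set_pmf p \<Longrightarrow> 0 < t x"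
    and int: "integrable (measure_pmf p) (\<lambda>x. ln (t x))"
    and mass: "(\<integral>\<^sup>+ x. ennreal (t x) \<partial>measure_pmf p) \<le> 1"
  shows "integrable (measure_pmf p) t" "(\<integral>x. t x \<partial>measure_pmf p) \<le> 1"
    "(\<integral>x. ln (t x) \<partial>measure_pmf p) \<le> 0"
proof -
  have nonneg: "AE x in measure_pmf p. 0 \<le> t x"
    by (rule AE_pmfI) (use pos in force)
  show int_t: "integrable (measure_pmf p) t"
    by (rule integrableI_nonneg) (use nonneg mass in \<open>auto intro: le_less_trans\<close>)
  have "ennreal (\<integral>x. t x \<partial>measure_pmf p) \<le> ennreal 1"
    using nn_integral_eq_integral[OF int_t nonneg] mass by simp
  then show le1: "(\<integral>x. t x \<partial>measure_pmf p) \<le> 1" by simp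
  have "(\<integral>x. ln (t x) \<partial>measure_pmf p) \<le> (\<integral>x. t x - 1 \<partial>measure_pmf p)"
    by (rule integral_mono_AE) (use int int_t pos in \<open>auto intro!: AE_pmfI ln_le_minus_one\<close>)
  also have "\<dots> \<le> 0" using int_t le1 by (simp add: measure_pmf.prob_space)
  finally show "(\<integral>x. ln (t x) \<partial>measure_pmf p) \<le> 0" .
qed

lemma pmf_map_snd: "ennreal (pmf (map_pmf snd R) c) = (\<integral>\<^sup>+ a. ennreal (pmf R (a, c)) \<partial>count_space UNIV)"
proof -
  have "ennreal (pmf (map_pmf snd R) c) = (\<integral>\<^sup>+ x. ennreal (pmf R x) * indicator (snd -` {c}) x \<partial>count_space UNIV)"
    by (subst ennreal_pmf_map) (rule nn_integral_measure_pmf)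
  also have "\<dots> = (\<integral>\<^sup>+ a. \<integral>\<^sup>+ d. ennreal (pmf R (a, d)) * indicator (snd -` {c}) (a, d) \<partial>count_space UNIV \<partial>count_space UNIV)"
    by (rule nn_integral_fst_count_space[symmetric])
  also have "\<dots> = (\<integral>\<^sup>+ a. \<integral>\<^sup>+ d. ennreal (pmf R (a, c)) * indicator {c} d \<partial>count_space UNIV \<partial>count_space UNIV)"
    by (intro nn_integral_cong) (auto simp: indicator_def)
  also have "\<dots> = (\<integral>\<^sup>+ a. ennreal (pmf R (a, c)) \<partial>count_space UNIV)"
    by (intro nn_integral_cong) (simp add: nn_integral_cmult_indicator)
  finally show ?thesis .
qed

text \<open>Strong subadditivity: conditional mutual information is nonnegative. Given the third
  component, the conditionally independent coupling of the other two has density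
  \<open>P\<^sub>A\<^sub>C P\<^sub>B\<^sub>C / P\<^sub>C\<close>, of total mass at most \<open>1\<close>; its ratio to \<open>J\<close> is the function \<open>t\<close> that goes into
  Gibbs' inequality.\<close>

lemma shannon_submodular:
  fixes J :: "('a \<times> 'b \<times> 'c) pmf"
  assumes fin: "entropy_pmf J < top"
  shows "shannon J + shannon (map_pmf (\<lambda>(a, b, c). c) J)
       \<le> shannon (map_pmf (\<lambda>(a, b, c). (a, c)) J) + shannon (map_pmf (\<lambda>(a, b, c). (b, c)) J)"
proof -
  let ?ac = "\<lambda>(a, b, c). (a, c) :: 'a \<times> 'c" and ?bc = "\<lambda>(a, b, c). (b, c) :: 'b \<times> 'c"
    and ?c = "\<lambda>(a :: 'a, b :: 'b, c). c :: 'c"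
  let ?AC = "map_pmf ?ac J" and ?BC = "map_pmf ?bc J" and ?C = "map_pmf ?c J"
  define t where "t x = pmf ?AC (?ac x) * pmf ?BC (?bc x) / (pmf J x * pmf ?C (?c x))" for x
  have pos: "0 < pmf J x" "0 < pmf ?AC (?ac x)" "0 < pmf ?BC (?bc x)" "0 < pmf ?C (?c x)"
    if "x \<in> set_pmf J" for x
    using that by (auto intro!: pmf_positive imageI)
  have fin': "entropy_pmf ?AC < top" "entropy_pmf ?BC < top" "entropy_pmf ?C < top"
    using fin entropy_map_le le_less_trans by blast+
  note int = integrable_surprisal[OF fin] fin'[THEN integrable_surprisal_map]
  have ln_t: "ln (t x) = ln (pmf ?AC (?ac x)) + ln (pmf ?BC (?bc x)) - ln (pmf J x) - ln (pmf ?C (?c x))"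
    if "x \<in> set_pmf J" for x
    using pos[OF that] by (simp add: t_def ln_div ln_mult)
  have int_rhs: "integrable (measure_pmf J) (\<lambda>x. ln (pmf ?AC (?ac x)) + ln (pmf ?BC (?bc x)) - ln (pmf J x) - ln (pmf ?C (?c x)))"
    using int by (intro Bochner_Integration.integrable_add Bochner_Integration.integrable_diff)
  have int_ln: "integrable (measure_pmf J) (\<lambda>x. ln (t x))"
    by (subst integrable_cong_AE[OF _ _ AE_pmfI[OF ln_t]]) (use int_rhs in auto)
  have C_marginal: "ennreal (pmf ?C c) = (\<integral>\<^sup>+ a. ennreal (pmf ?AC (a, c)) \<partial>count_space UNIV)" for c
    unfolding pmf_map_snd[symmetric] by (simp add: map_pmf_comp split_beta')
  have "(\<integral>\<^sup>+ x. ennreal (t x) \<partial>measure_pmf J) = (\<integral>\<^sup>+ x. ennreal (pmf J x * t x) \<partial>count_space UNIV)"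
    by (simp add: nn_integral_measure_pmf ennreal_mult')
  also have "\<dots> \<le> (\<integral>\<^sup>+ x. ennreal (pmf ?AC (?ac x) * pmf ?BC (?bc x) / pmf ?C (?c x)) \<partial>count_space UNIV)"
    by (intro nn_integral_mono ennreal_leI) (auto simp: t_def)
  also have "\<dots> = (\<integral>\<^sup>+ bc. \<integral>\<^sup>+ a. ennreal (pmf ?AC (a, snd bc) * pmf ?BC bc / pmf ?C (snd bc)) \<partial>count_space UNIV \<partial>count_space UNIV)"
    by (subst nn_integral_snd_count_space[symmetric]) (simp add: case_prod_beta)
  also have "\<dots> = (\<integral>\<^sup>+ bc. ennreal (pmf ?BC bc / pmf ?C (snd bc)) * (\<integral>\<^sup>+ a. ennreal (pmf ?AC (a, snd bc)) \<partial>count_space UNIV) \<partial>count_space UNIV)"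
    by (subst nn_integral_cmult[symmetric]) (auto intro!: nn_integral_cong simp: ennreal_mult'[symmetric] mult_ac)
  also have "\<dots> = (\<integral>\<^sup>+ bc. ennreal (pmf ?BC bc / pmf ?C (snd bc)) * ennreal (pmf ?C (snd bc)) \<partial>count_space UNIV)"
    by (simp only: C_marginal)
  also have "\<dots> \<le> (\<integral>\<^sup>+ bc. ennreal (pmf ?BC bc) \<partial>count_space UNIV)"
    by (intro nn_integral_mono) (auto simp: ennreal_mult''[symmetric] intro!: ennreal_leI)
  also have "\<dots> = 1"
    by (simp add: nn_integral_pmf del: emeasure_map_pmf)
  finally have mass: "(\<integral>\<^sup>+ x. ennreal (t x) \<partial>measure_pmf J) \<le> 1" .
  have "0 \<ge> (\<integral>x. ln (t x) \<partial>measure_pmf J)"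
    by (rule gibbs_inequality(3)[OF _ int_ln mass]) (simp only: t_def divide_pos_pos mult_pos_pos pos)
  also have "(\<integral>x. ln (t x) \<partial>measure_pmf J) =
      (\<integral>x. ln (pmf ?AC (?ac x)) + ln (pmf ?BC (?bc x)) - ln (pmf J x) - ln (pmf ?C (?c x)) \<partial>measure_pmf J)"
    by (rule integral_cong_AE[OF _ _ AE_pmfI[OF ln_t]]) simp_all
  also have "\<dots> = (\<integral>x. ln (pmf ?AC (?ac x)) \<partial>measure_pmf J) + (\<integral>x. ln (pmf ?BC (?bc x)) \<partial>measure_pmf J)
      - (\<integral>x. ln (pmf J x) \<partial>measure_pmf J) - (\<integral>x. ln (pmf ?C (?c x)) \<partial>measure_pmf J)"
    using int by (simp only: Bochner_Integration.integral_diff Bochner_Integration.integral_add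
        Bochner_Integration.integrable_diff Bochner_Integration.integrable_add)
  finally show ?thesis
    unfolding shannon_map shannon_def[of J] by simp
qed

lemma conv_pmf_altdef: "conv_pmf p q = bind_pmf p (\<lambda>g. map_pmf ((+) g) q)"
  by (simp add: conv_pmf_def pair_pmf_def map_pmf_def bind_assoc_pmf bind_return_pmf)

lemma pmf_map_plus: "pmf (map_pmf ((+) g) q) (y :: 'g :: group_add) = pmf q (- g + y)"
  using pmf_map_inj'[of "(+) g" q "- g + y"] by (simp add: inj_def add.assoc[symmetric])

lemma pmf_conv:
  "ennreal (pmf (conv_pmf p q) y) = (\<integral>\<^sup>+ g. ennreal (pmf p g) * ennreal (pmf q (- g + y)) \<partial>count_space UNIV)"
  unfolding conv_pmf_altdef by (simp add: ennreal_pmf_bind nn_integral_measure_pmf pmf_map_plus)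

lemma conv_return_0_left [simp]: "conv_pmf (return_pmf 0) q = q"
  by (simp add: conv_pmf_altdef bind_return_pmf map_pmf_idI)

lemma conv_return_0_right [simp]: "conv_pmf p (return_pmf 0) = p"
  by (simp add: conv_pmf_altdef bind_return_pmf')

lemma conv_assoc: "conv_pmf (conv_pmf p q) r = conv_pmf p (conv_pmf q r)"
proof -
  have *: "(+) (x + y) = (\<lambda>z. x + (y + z))" for x y :: 'a
    by (simp add: fun_eq_iff add.assoc)
  show ?thesis by (simp add: conv_pmf_altdef bind_assoc_pmf map_bind_pmf bind_map_pmf map_pmf_comp *)
qed

lemma entropy_conv_finite:
  assumes "entropy_pmf p < top" "entropy_pmf q < top"
  shows "entropy_pmf (conv_pmf p q) < top"
proof -
  have "entropy_pmf (conv_pmf p q) \<le> entropy_pmf (pair_pmf p q)"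
    unfolding conv_pmf_def by (rule entropy_map_le)
  also have "\<dots> < top" using assms by (simp add: entropy_pair)
  finally show ?thesis .
qed

text \<open>For independent increments \<open>g, h, k\<close> this is strong subadditivity for the triple
  \<open>(g, g + h, g + h + k)\<close>: partial sums determine increments, so all joint entropies split into
  sums of entropies of increments and convolutions. It says that \<open>x\<^sub>1\<close> shares less information with
  a later position of the walk.\<close>

lemma shannon_conv_submodular:
  assumes a: "entropy_pmf a < top" and b: "entropy_pmf b < top" and c: "entropy_pmf c < top"
  shows "shannon b + shannon (conv_pmf a (conv_pmf b c)) \<le> shannon (conv_pmf b c) + shannon (conv_pmf a b)"
proof -
  let ?P = "pair_pmf a (pair_pmf b c)"
  define J where "J = map_pmf (\<lambda>(g, h, k). (g, g + h, g + (h + k))) ?P"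
  have P: "entropy_pmf ?P < top" using a b c by (simp add: entropy_pair)
  have sJ: "shannon J = shannon a + shannon b + shannon c"
    unfolding J_def by (subst shannon_map_inj) (auto simp: inj_def shannon_pair a b c entropy_pair)
  have J: "entropy_pmf J < top"
    unfolding J_def using entropy_map_le P by (rule le_less_trans)
  have 1: "map_pmf (\<lambda>(x, y, z). z) J = conv_pmf a (conv_pmf b c)"
    by (simp add: J_def conv_pmf_def map_pmf_comp case_prod_beta pair_map_pmf2 apsnd_def map_prod_def)
  have "map_pmf (\<lambda>(x, y, z). (x, z)) J = map_pmf (\<lambda>(g, u). (g, g + u)) (pair_pmf a (conv_pmf b c))"
    by (simp add: J_def conv_pmf_def map_pmf_comp case_prod_beta pair_map_pmf2 apsnd_def map_prod_def)
  then have 2: "shannon (map_pmf (\<lambda>(x, y, z). (x, z)) J) = shannon a + shannon (conv_pmf b c)"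
    by (simp add: shannon_map_inj inj_def shannon_pair a b c entropy_conv_finite)
  have "map_pmf (\<lambda>(x, y, z). (y, z)) J = map_pmf (\<lambda>(u, k). (u, u + k)) (pair_pmf (conv_pmf a b) c)"
    by (simp add: J_def conv_pmf_def map_pmf_comp case_prod_beta pair_map_pmf1 apfst_def map_prod_def
        pair_pair_pmf add.assoc)
  then have 3: "shannon (map_pmf (\<lambda>(x, y, z). (y, z)) J) = shannon (conv_pmf a b) + shannon c"
    by (simp add: shannon_map_inj inj_def shannon_pair a b c entropy_conv_finite)
  show ?thesis
    using shannon_submodular[OF J] unfolding sJ 1 2 3 by simp
qed

text \<open>Subadditivity for the pair \<open>(g, g + h)\<close>, whose joint entropy is the sum of both entropies. It is
  obtained from the conditional version with a trivial third component.\<close>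

lemma shannon_conv_ge_right:
  assumes a: "entropy_pmf a < top" and b: "entropy_pmf b < top"
  shows "shannon b \<le> shannon (conv_pmf a b)"
proof -
  let ?J = "map_pmf (\<lambda>(g, h). (g, g + h)) (pair_pmf a b)"
  have sJ: "shannon ?J = shannon a + shannon b"
    by (subst shannon_map_inj) (auto simp: inj_def shannon_pair a b)
  have J: "entropy_pmf ?J < top"
    by (rule le_less_trans[OF entropy_map_le]) (use a b in \<open>simp add: entropy_pair\<close>)
  let ?J' = "map_pmf (\<lambda>(x, y). (x, y, ())) ?J"
  have J': "entropy_pmf ?J' < top" using entropy_map_le J by (rule le_less_trans)
  have "shannon ?J' = shannon ?J" by (rule shannon_map_inj) (auto simp: inj_def)
  moreover have "map_pmf (\<lambda>(x, y, z). z) ?J' = return_pmf ()"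
    by (simp add: map_pmf_comp case_prod_beta)
  moreover have "shannon (map_pmf (\<lambda>(x, y, z). (x, z)) ?J') = shannon a"
  proof -
    have "map_pmf (\<lambda>(x, y, z). (x, z)) ?J' = map_pmf (\<lambda>x. (x, ())) (map_pmf fst (pair_pmf a b))"
      by (simp add: map_pmf_comp case_prod_beta)
    then show ?thesis by (simp add: map_fst_pair_pmf shannon_map_inj inj_def)
  qed
  moreover have "shannon (map_pmf (\<lambda>(x, y, z). (y, z)) ?J') = shannon (conv_pmf a b)"
  proof -
    have "map_pmf (\<lambda>(x, y, z). (y, z)) ?J' = map_pmf (\<lambda>x. (x, ())) (conv_pmf a b)"
      by (simp add: map_pmf_comp case_prod_beta conv_pmf_def)
    then show ?thesis by (simp add: shannon_map_inj inj_def)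
  qed
  ultimately show ?thesis using shannon_submodular[OF J'] sJ by simp
qed

lemma integral_pair_fst: "(\<integral>x. f (fst x) \<partial>measure_pmf (pair_pmf a b)) = (\<integral>x. f x \<partial>measure_pmf a :: real)"
  by simp

text \<open>The difference of entropies on the left is the mutual information between an increment \<open>g\<close> and
  the sum \<open>g + h\<close>; the ratio inside the logarithm compares the law of the sum with its conditional
  law given \<open>g\<close>. Both entropy estimates of the next part start from this representation.\<close>

lemma information_integral:
  assumes a: "entropy_pmf a < top" and b: "entropy_pmf b < top"
  defines "r \<equiv> conv_pmf a b"
  shows "integrable (measure_pmf (pair_pmf a b)) (\<lambda>(g, h). ln (pmf r (g + h) / pmf b h))"
    and "shannon r - shannon b = - (\<integral>(g, h). ln (pmf r (g + h) / pmf b h) \<partial>measure_pmf (pair_pmf a b))"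
proof -
  let ?P = "pair_pmf a b"
  have r: "r = map_pmf (\<lambda>(g, h). g + h) ?P" by (simp add: r_def conv_pmf_def)
  have b': "b = map_pmf snd ?P" by (simp add: map_snd_pair_pmf)
  have fin_r: "entropy_pmf r < top" unfolding r_def by (rule entropy_conv_finite[OF a b])
  have int: "integrable (measure_pmf ?P) (\<lambda>x. ln (pmf r (case x of (g, h) \<Rightarrow> g + h)))"
      "integrable (measure_pmf ?P) (\<lambda>x. ln (pmf b (snd x)))"
    using integrable_surprisal_map[of "\<lambda>(g, h). g + h" ?P, folded r, OF fin_r]
      integrable_surprisal_map[of snd ?P, folded b', OF b] by auto
  have eq: "AE x in measure_pmf ?P. (case x of (g, h) \<Rightarrow> ln (pmf r (g + h) / pmf b h))
      = ln (pmf r (case x of (g, h) \<Rightarrow> g + h)) - ln (pmf b (snd x))"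
  proof (rule AE_pmfI)
    fix x assume x: "x \<in> set_pmf ?P"
    then have "0 < pmf r (case x of (g, h) \<Rightarrow> g + h)" "0 < pmf b (snd x)"
      unfolding r by (auto intro!: pmf_positive)
    then show "(case x of (g, h) \<Rightarrow> ln (pmf r (g + h) / pmf b h))
      = ln (pmf r (case x of (g, h) \<Rightarrow> g + h)) - ln (pmf b (snd x))"
      by (cases x) (simp add: ln_div)
  qed
  show "integrable (measure_pmf ?P) (\<lambda>(g, h). ln (pmf r (g + h) / pmf b h))"
    by (subst integrable_cong_AE[OF _ _ eq]) (use int in auto)
  have "(\<integral>(g, h). ln (pmf r (g + h) / pmf b h) \<partial>measure_pmf ?P) =
      (\<integral>x. ln (pmf r (case x of (g, h) \<Rightarrow> g + h)) - ln (pmf b (snd x)) \<partial>measure_pmf ?P)"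
    by (rule integral_cong_AE[OF _ _ eq]) auto
  also have "\<dots> = (\<integral>x. ln (pmf r (case x of (g, h) \<Rightarrow> g + h)) \<partial>measure_pmf ?P) - (\<integral>x. ln (pmf b (snd x)) \<partial>measure_pmf ?P)"
    by (rule Bochner_Integration.integral_diff[OF int])
  also have "(\<integral>x. ln (pmf r (case x of (g, h) \<Rightarrow> g + h)) \<partial>measure_pmf ?P) = - shannon r"
    using shannon_map[of "\<lambda>(g, h). g + h" ?P, folded r] by simp
  also have "(\<integral>x. ln (pmf b (snd x)) \<partial>measure_pmf ?P) = - shannon b"
    using shannon_map[of snd ?P, folded b'] by simp
  finally show "shannon r - shannon b = - (\<integral>(g, h). ln (pmf r (g + h) / pmf b h) \<partial>measure_pmf ?P)"
    by simp
qed

section \<open>Quantitative comparison of information and dependence\<close>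

text \<open>A pointwise substitute for Pinsker's inequality. With \<open>v = 1 - \<surd>t\<close>, the bound \<open>ln t \<le> 2 (\<surd>t - 1)\<close>
  gives \<open>v\<^sup>2 \<le> t - 1 - ln t\<close>, while \<open>1 - t \<le> 2 v\<close> for \<open>t \<le> 1\<close>; a free parameter \<open>e\<close> then replaces the
  Cauchy-Schwarz inequality.\<close>

lemma deficit_le_log_deficit:
  fixes t e s :: real
  assumes t: "0 < t" and e: "0 < e" and s: "0 \<le> s" "s \<le> 1"
  shows "(1 - t) * s \<le> e + (t - 1 - ln t) / e"
proof -
  define v where "v = 1 - sqrt t"
  have ln_t: "ln t \<le> 2 * (sqrt t - 1)"
    using ln_le_minus_one[of "sqrt t"] t by (simp add: ln_sqrt)
  have sq: "v\<^sup>2 \<le> t - 1 - ln t"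
    using ln_t t by (simp add: v_def power2_eq_square algebra_simps)
  have "(1 - t) * s \<le> e + v\<^sup>2 / e"
  proof (cases "t \<le> 1")
    case True
    have "(1 - t) * s \<le> 1 - t" using True s by (simp add: mult_left_le)
    also have "1 - t = v * (1 + sqrt t)"
      using t by (simp add: v_def algebra_simps)
    also have "\<dots> \<le> v * 2"
      using True by (intro mult_left_mono) (auto simp: v_def)
    also have "\<dots> \<le> e + v\<^sup>2 / e"
    proof -
      have "0 \<le> (e - v)\<^sup>2" by simp
      then have "v * 2 * e \<le> e * e + v\<^sup>2" by (simp add: power2_eq_square algebra_simps)
      then show ?thesis using e by (simp add: field_simps power2_eq_square)
    qed
    finally show ?thesis .
  next
    case False
    then have "(1 - t) * s \<le> 0" using s by (simp add: mult_nonpos_nonneg)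
    also have "0 \<le> e + v\<^sup>2 / e" using e by simp
    finally show ?thesis .
  qed
  also have "\<dots> \<le> e + (t - 1 - ln t) / e"
    using sq e by (simp add: divide_right_mono)
  finally show ?thesis .
qed

lemma nn_integral_count_space_translate:
  fixes k :: "'g :: group_add"
  shows "(\<integral>\<^sup>+ h. f (k + h) \<partial>count_space UNIV) = (\<integral>\<^sup>+ y. f y \<partial>count_space UNIV)"
  by (rule nn_integral_bij_count_space)
    (auto intro!: bij_betwI[where g="\<lambda>y. - k + y"] simp: add.assoc[symmetric])

text \<open>The weight is the density of the product of the marginal laws of \<open>g\<close> and \<open>g + h\<close> with respect to
  their joint law. Only an inequality holds, since the product may charge points outside the
  support of the joint law.\<close>

lemma change_to_product_law:
  fixes a b :: "'g :: group_add pmf"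
  shows "(\<integral>\<^sup>+ (g, h). ennreal (pmf r (g + h) / pmf b h) * F g (g + h) \<partial>measure_pmf (pair_pmf a b))
       \<le> (\<integral>\<^sup>+ g. \<integral>\<^sup>+ y. F g y \<partial>measure_pmf r \<partial>measure_pmf a)"
  unfolding nn_integral_pair_pmf'
proof (rule nn_integral_mono, simp)
  fix g
  have "(\<integral>\<^sup>+ h. ennreal (pmf r (g + h) / pmf b h) * F g (g + h) \<partial>measure_pmf b)
      = (\<integral>\<^sup>+ h. ennreal (pmf b h) * ennreal (pmf r (g + h) / pmf b h) * F g (g + h) \<partial>count_space UNIV)"
    by (simp add: nn_integral_measure_pmf mult.assoc)
  also have "\<dots> \<le> (\<integral>\<^sup>+ h. ennreal (pmf r (g + h)) * F g (g + h) \<partial>count_space UNIV)"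
    by (intro nn_integral_mono mult_right_mono) (auto simp: ennreal_mult'[symmetric] intro!: ennreal_leI)
  also have "\<dots> = (\<integral>\<^sup>+ y. ennreal (pmf r y) * F g y \<partial>count_space UNIV)"
    by (rule nn_integral_count_space_translate)
  also have "\<dots> = (\<integral>\<^sup>+ y. F g y \<partial>measure_pmf r)"
    by (simp add: nn_integral_measure_pmf)
  finally show "(\<integral>\<^sup>+ h. ennreal (pmf r (g + h) / pmf b h) * F g (g + h) \<partial>measure_pmf b)
      \<le> (\<integral>\<^sup>+ y. F g y \<partial>measure_pmf r)" .
qed

text \<open>The left side is the covariance between the event that the first position is \<open>k\<close> and a function
  of the second position; \<open>t\<close> is the density of the product of the marginals, so the covariance is
  at most the mean of \<open>(1 - t) \<phi>\<close>, and the pointwise bound applies. Only one sign of the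
  covariance is controlled; the other follows by passing to \<open>1 - \<psi>\<close>.\<close>

lemma correlation_le_information:
  fixes a b :: "'g :: group_add pmf"
  assumes a: "entropy_pmf a < top" and b: "entropy_pmf b < top"
    and e: "0 < e" and \<psi>: "\<And>y. 0 \<le> \<psi> y" "\<And>y. \<psi> y \<le> 1"
  defines "r \<equiv> conv_pmf a b"
  shows "(\<integral>(g, h). indicator {k} g * \<psi> (g + h) \<partial>measure_pmf (pair_pmf a b))
      - pmf a k * (\<integral>y. \<psi> y \<partial>measure_pmf r) \<le> e + (shannon r - shannon b) / e"
proof -
  let ?P = "measure_pmf (pair_pmf a b)"
  define t where "t x = (case x of (g, h) \<Rightarrow> pmf r (g + h) / pmf b h)" for x
  define \<phi> where "\<phi> x = (case x of (g, h) \<Rightarrow> indicator {k} g * \<psi> (g + h))" for x :: "'g \<times> 'g"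
  have t_pos: "0 < t x" if "x \<in> set_pmf (pair_pmf a b)" for x
    using that by (force simp: t_def r_def conv_pmf_def intro!: divide_pos_pos pmf_positive)
  have t_nonneg: "0 \<le> t x" for x by (simp add: t_def split: prod.split)
  have \<phi>: "0 \<le> \<phi> x" "\<phi> x \<le> 1" for x
    using \<psi> by (cases x; simp add: \<phi>_def indicator_def)+
  have int_ln: "integrable ?P (\<lambda>x. ln (t x))" and info: "shannon r - shannon b = - (\<integral>x. ln (t x) \<partial>?P)"
    using information_integral[OF a b] unfolding t_def r_def by (simp_all add: split_beta')
  have "(\<integral>\<^sup>+ x. ennreal (t x) \<partial>?P) \<le> (\<integral>\<^sup>+ g. \<integral>\<^sup>+ y. 1 \<partial>measure_pmf r \<partial>measure_pmf a)"
    using change_to_product_law[where r=r and b=b and a=a and F="\<lambda>_ _. 1"] by (simp add: t_def split_beta')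
  then have mass: "(\<integral>\<^sup>+ x. ennreal (t x) \<partial>?P) \<le> 1" by simp
  note t = gibbs_inequality[OF t_pos int_ln mass]
  have int_\<phi>: "integrable ?P \<phi>"
    by (rule measure_pmf.integrable_const_bound[where B=1]) (use \<phi> in auto)
  have int_t\<phi>: "integrable ?P (\<lambda>x. t x * \<phi> x)"
    by (rule Bochner_Integration.integrable_bound[OF t(1)])
      (use \<phi> t_nonneg in \<open>auto simp: abs_mult intro!: mult_left_le\<close>)
  have int_\<psi>: "integrable (measure_pmf r) \<psi>"
    by (rule measure_pmf.integrable_const_bound[where B=1]) (use \<psi> in auto)
  have "ennreal (\<integral>x. t x * \<phi> x \<partial>?P) = (\<integral>\<^sup>+ x. ennreal (t x * \<phi> x) \<partial>?P)"
    by (rule nn_integral_eq_integral[symmetric, OF int_t\<phi>]) (use \<phi> t_nonneg in auto)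
  also have "\<dots> = (\<integral>\<^sup>+ (g, h). ennreal (pmf r (g + h) / pmf b h) * (indicator {k} g * ennreal (\<psi> (g + h))) \<partial>?P)"
    by (intro nn_integral_cong) (auto simp: t_def \<phi>_def indicator_def ennreal_mult'[symmetric] split: prod.split)
  also have "\<dots> \<le> (\<integral>\<^sup>+ g. \<integral>\<^sup>+ y. indicator {k} g * ennreal (\<psi> y) \<partial>measure_pmf r \<partial>measure_pmf a)"
    by (rule change_to_product_law)
  also have "\<dots> = (\<integral>\<^sup>+ g. ennreal (\<integral>y. \<psi> y \<partial>measure_pmf r) * indicator {k} g \<partial>measure_pmf a)"
  proof (rule nn_integral_cong)
    fix g
    show "(\<integral>\<^sup>+ y. indicator {k} g * ennreal (\<psi> y) \<partial>measure_pmf r) = ennreal (\<integral>y. \<psi> y \<partial>measure_pmf r) * indicator {k} g"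
      by (subst nn_integral_cmult) (auto simp: nn_integral_eq_integral[OF int_\<psi>] \<psi> mult.commute)
  qed
  also have "\<dots> = ennreal (pmf a k * (\<integral>y. \<psi> y \<partial>measure_pmf r))"
    by (simp add: nn_integral_cmult_indicator emeasure_pmf_single ennreal_mult' mult.commute)
  finally have le: "(\<integral>x. t x * \<phi> x \<partial>?P) \<le> pmf a k * (\<integral>y. \<psi> y \<partial>measure_pmf r)"
    using \<psi> by (subst (asm) ennreal_le_iff) (auto intro!: mult_nonneg_nonneg Bochner_Integration.integral_nonneg)
  have "(\<integral>x. \<phi> x \<partial>?P) - (\<integral>x. t x * \<phi> x \<partial>?P) = (\<integral>x. (1 - t x) * \<phi> x \<partial>?P)"
    using int_\<phi> int_t\<phi> by (simp add: left_diff_distrib)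
  also have "\<dots> \<le> (\<integral>x. e + (t x - 1 - ln (t x)) / e \<partial>?P)"
  proof (rule integral_mono_AE)
    show "AE x in ?P. (1 - t x) * \<phi> x \<le> e + (t x - 1 - ln (t x)) / e"
      by (rule AE_pmfI) (use deficit_le_log_deficit t_pos e \<phi> in blast)
  qed (use int_\<phi> int_t\<phi> t(1) int_ln in \<open>auto simp: left_diff_distrib\<close>)
  also have "\<dots> = e + ((\<integral>x. t x \<partial>?P) - 1 - (\<integral>x. ln (t x) \<partial>?P)) / e"
    using t(1) int_ln by (simp add: measure_pmf.prob_space)
  also have "\<dots> \<le> e + (shannon r - shannon b) / e"
    using t(2) e unfolding info
    by (intro add_left_mono divide_right_mono) auto
  finally show ?thesis
    using le unfolding \<phi>_def by (simp add: split_beta')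
qed

text \<open>Bayes' formula: the ratio is the conditional probability that the first increment is \<open>k\<close>, given
  that the sum is \<open>y\<close>.\<close>

lemma conditional_prob_bounds:
  fixes a b :: "'g :: group_add pmf"
  shows "pmf a k * pmf b (- k + y) / pmf (conv_pmf a b) y \<le> 1"
    and "0 \<le> pmf a k * pmf b (- k + y) / pmf (conv_pmf a b) y"
    and "pmf a k * pmf b h \<le> pmf (conv_pmf a b) (k + h)"
proof -
  show *: "pmf a k * pmf b h \<le> pmf (conv_pmf a b) (k + h)" for h
    using pmf_map_ge[of "pair_pmf a b" "(k, h)" "\<lambda>(g, h). g + h"] by (simp add: pmf_pair conv_pmf_def)
  show "pmf a k * pmf b (- k + y) / pmf (conv_pmf a b) y \<le> 1"
    using *[of "- k + y"] by (auto simp: divide_le_eq_1 add.assoc[symmetric] less_le)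
qed simp

text \<open>The information is the mean of \<open>ln L\<close>, where \<open>L = b(h) / r(g + h)\<close> is the density of the joint law
  of \<open>g\<close> and \<open>g + h\<close> with respect to the product of the marginals. For \<open>g\<close> in the finite set \<open>F\<close> use
  \<open>ln L \<le> L - 1\<close>: the conditional probability of \<open>g = k\<close> given the sum is \<open>a(k) L\<close>, so the resulting
  summand is the variance of this conditional probability divided by its mean. For the remaining
  \<open>g\<close> use \<open>L \<le> 1 / a(g)\<close>, which leaves a tail of the entropy series of \<open>a\<close>. A point \<open>k\<close> with
  \<open>a(k) = 0\<close> contributes \<open>0\<close>, by the convention \<open>x / 0 = 0\<close>.\<close>

lemma information_le_conditional_variances:
  fixes a b :: "'g :: group_add pmf"
  assumes a: "entropy_pmf a < top" and b: "entropy_pmf b < top" and F: "finite F"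
  defines "r \<equiv> conv_pmf a b"
  shows "shannon r - shannon b \<le>
      (\<Sum>k\<in>F. (\<integral>y. (pmf a k * pmf b (- k + y) / pmf r y)\<^sup>2 \<partial>measure_pmf r) / pmf a k - pmf a k)
      + (\<integral>g. indicator (- F) g * (- ln (pmf a g)) \<partial>measure_pmf a)"
proof -
  let ?P = "measure_pmf (pair_pmf a b)"
  define L where "L x = (case x of (g, h) \<Rightarrow> pmf b h / pmf r (g + h))" for x
  have L_nonneg: "0 \<le> L x" for x by (simp add: L_def split: prod.split)
  have pos: "0 < pmf a (fst x)" "0 < pmf b (snd x)" "0 < pmf r (fst x + snd x)"
    if "x \<in> set_pmf (pair_pmf a b)" for x
    using that by (force simp: r_def conv_pmf_def intro!: pmf_positive)+
  have L_le: "L x \<le> 1 / pmf a (fst x)" if "x \<in> set_pmf (pair_pmf a b)" for x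
    using conditional_prob_bounds(3)[of a "fst x" b "snd x"] pos[OF that]
    by (simp add: L_def r_def case_prod_beta field_simps)
  have L_pos: "0 < L x" if "x \<in> set_pmf (pair_pmf a b)" for x
    using pos[OF that] by (simp add: L_def case_prod_beta)
  have int_kL: "integrable ?P (\<lambda>x. indicator {k} (fst x) * L x)" for k
    by (rule measure_pmf.integrable_const_bound[where B="1 / pmf a k"])
      (use L_le L_nonneg in \<open>auto intro!: AE_pmfI simp: indicator_def\<close>)
  have kL: "(\<integral>x. indicator {k} (fst x) * L x \<partial>?P) =
      (\<integral>y. (pmf a k * pmf b (- k + y) / pmf r y)\<^sup>2 \<partial>measure_pmf r) / pmf a k" for k
  proof (cases "pmf a k = 0")
    case True
    then have "AE x in ?P. indicator {k} (fst x) * L x = 0"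
      by (intro AE_pmfI) (auto simp: indicator_def set_pmf_iff)
    then have "(\<integral>x. indicator {k} (fst x) * L x \<partial>?P) = 0" by (rule integral_eq_zero_AE)
    then show ?thesis using True by simp
  next
    case False
    let ?c = "\<lambda>y. pmf b (- k + y) / pmf r y"
    have int: "integrable (measure_pmf r) (\<lambda>y. (pmf a k * pmf b (- k + y) / pmf r y)\<^sup>2)"
      by (rule measure_pmf.integrable_const_bound[where B=1])
        (use conditional_prob_bounds[of a k b] in \<open>auto simp: r_def intro!: power_le_one\<close>)
    have "ennreal (\<integral>x. indicator {k} (fst x) * L x \<partial>?P) = (\<integral>\<^sup>+ x. ennreal (indicator {k} (fst x) * L x) \<partial>?P)"
      by (rule nn_integral_eq_integral[symmetric, OF int_kL]) (use L_nonneg in auto)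
    also have "\<dots> = (\<integral>\<^sup>+ g. (\<integral>\<^sup>+ h. ennreal (pmf b h / pmf r (k + h)) \<partial>measure_pmf b) * indicator {k} g \<partial>measure_pmf a)"
      unfolding nn_integral_pair_pmf' by (intro nn_integral_cong) (auto simp: L_def indicator_def)
    also have "\<dots> = ennreal (pmf a k) * (\<integral>\<^sup>+ h. ennreal (pmf b h * (pmf b h / pmf r (k + h))) \<partial>count_space UNIV)"
      unfolding nn_integral_measure_pmf[of b]
      by (subst nn_integral_cmult_indicator) (auto simp: emeasure_pmf_single ennreal_mult'[symmetric] mult.commute)
    also have "(\<integral>\<^sup>+ h. ennreal (pmf b h * (pmf b h / pmf r (k + h))) \<partial>count_space UNIV)
        = (\<integral>\<^sup>+ h. ennreal (pmf b (- k + (k + h)) * ?c (k + h)) \<partial>count_space UNIV)"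
      by (simp add: add.assoc[symmetric])
    also have "\<dots> = (\<integral>\<^sup>+ y. ennreal (pmf b (- k + y) * ?c y) \<partial>count_space UNIV)"
      by (rule nn_integral_count_space_translate[where f="\<lambda>y. ennreal (pmf b (- k + y) * ?c y)"])
    finally have 1: "ennreal (\<integral>x. indicator {k} (fst x) * L x \<partial>?P) =
        ennreal (pmf a k) * (\<integral>\<^sup>+ y. ennreal (pmf b (- k + y) * ?c y) \<partial>count_space UNIV)" .
    have "ennreal (\<integral>y. (pmf a k * pmf b (- k + y) / pmf r y)\<^sup>2 \<partial>measure_pmf r) =
        (\<integral>\<^sup>+ y. ennreal ((pmf a k * pmf b (- k + y) / pmf r y)\<^sup>2) \<partial>measure_pmf r)"
      by (rule nn_integral_eq_integral[symmetric, OF int]) auto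
    also have "\<dots> = (\<integral>\<^sup>+ y. ennreal (pmf a k) * (ennreal (pmf a k) * ennreal (pmf b (- k + y) * ?c y)) \<partial>count_space UNIV)"
      unfolding nn_integral_measure_pmf
      by (intro nn_integral_cong) (auto simp: ennreal_mult'[symmetric] power2_eq_square)
    also have "\<dots> = ennreal (pmf a k) * ennreal (\<integral>x. indicator {k} (fst x) * L x \<partial>?P)"
      unfolding 1 by (simp add: nn_integral_cmult)
    also have "\<dots> = ennreal (pmf a k * (\<integral>x. indicator {k} (fst x) * L x \<partial>?P))"
      by (simp add: ennreal_mult')
    finally have "(\<integral>y. (pmf a k * pmf b (- k + y) / pmf r y)\<^sup>2 \<partial>measure_pmf r) =
        pmf a k * (\<integral>x. indicator {k} (fst x) * L x \<partial>?P)"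
      by (subst (asm) ennreal_inj) (auto intro!: Bochner_Integration.integral_nonneg mult_nonneg_nonneg L_nonneg)
    then show ?thesis using False by simp
  qed
  have int_k: "integrable ?P (\<lambda>x. indicator {k} (fst x) :: real)" for k
    by (rule measure_pmf.integrable_const_bound[where B=1]) auto
  have E_k: "(\<integral>x. indicator {k} (fst x) \<partial>?P) = pmf a k" for k
    using integral_pair_fst[where f="indicator {k}" and a=a and b=b] by (simp add: measure_pmf_single)
  have int_out: "integrable (measure_pmf a) (\<lambda>g. indicator (- F) g * (- ln (pmf a g)))"
    using integrable_mult_indicator[of "- F" "measure_pmf a" "\<lambda>g. - ln (pmf a g)"] integrable_surprisal[OF a] by simp
  then have "integrable (measure_pmf (map_pmf fst (pair_pmf a b))) (\<lambda>g. indicator (- F) g * (- ln (pmf a g)))"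
    by (simp only: map_fst_pair_pmf)
  then have int_out': "integrable ?P (\<lambda>x. indicator (- F) (fst x) * (- ln (pmf a (fst x))))"
    by simp
  have ln_L: "ln (L x) = - ln (pmf r (fst x + snd x) / pmf b (snd x))"
    if "x \<in> set_pmf (pair_pmf a b)" for x
    using pos[OF that] by (simp add: L_def case_prod_beta ln_div)
  have int_ln: "integrable ?P (\<lambda>x. ln (L x))"
    by (subst integrable_cong_AE[OF _ _ AE_pmfI[OF ln_L]])
      (use information_integral(1)[OF a b] in \<open>auto simp: r_def split_beta'\<close>)
  have "shannon r - shannon b = (\<integral>x. ln (L x) \<partial>?P)"
    using information_integral(2)[OF a b]
    by (subst integral_cong_AE[OF _ _ AE_pmfI[OF ln_L]]) (auto simp: r_def split_beta')
  also have "\<dots> \<le> (\<integral>x. (\<Sum>k\<in>F. indicator {k} (fst x) * L x - indicator {k} (fst x))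
      + indicator (- F) (fst x) * (- ln (pmf a (fst x))) \<partial>?P)"
  proof (rule integral_mono_AE[OF int_ln])
    show "AE x in ?P. ln (L x) \<le> (\<Sum>k\<in>F. indicator {k} (fst x) * L x - indicator {k} (fst x))
      + indicator (- F) (fst x) * (- ln (pmf a (fst x)))"
    proof (rule AE_pmfI)
      fix x assume x: "x \<in> set_pmf (pair_pmf a b)"
      have "(\<Sum>k\<in>F. indicator {k} (fst x) * L x - indicator {k} (fst x)) = (\<Sum>k\<in>F. if k = fst x then L x - 1 else 0)"
        by (intro sum.cong) (auto simp: indicator_def)
      also have "\<dots> = (if fst x \<in> F then L x - 1 else 0)"
        using F by simp
      finally have sum: "(\<Sum>k\<in>F. indicator {k} (fst x) * L x - indicator {k} (fst x)) = (if fst x \<in> F then L x - 1 else 0)" .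
      have "ln (L x) \<le> ln (1 / pmf a (fst x))"
        using L_le[OF x] L_pos[OF x] pos[OF x] by (subst ln_le_cancel_iff) auto
      then have "ln (L x) \<le> - ln (pmf a (fst x))"
        using pos[OF x] by (simp add: ln_div)
      with ln_le_minus_one[OF L_pos[OF x]] sum
      show "ln (L x) \<le> (\<Sum>k\<in>F. indicator {k} (fst x) * L x - indicator {k} (fst x))
          + indicator (- F) (fst x) * (- ln (pmf a (fst x)))"
        by auto
    qed
  qed (intro Bochner_Integration.integrable_add Bochner_Integration.integrable_sum
      Bochner_Integration.integrable_diff int_kL int_k int_out')
  also have "\<dots> = (\<Sum>k\<in>F. (\<integral>x. indicator {k} (fst x) * L x \<partial>?P) - pmf a k)
      + (\<integral>x. indicator (- F) (fst x) * (- ln (pmf a (fst x))) \<partial>?P)"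
    using int_kL int_k int_out'
    by (subst Bochner_Integration.integral_add)
      (auto simp: Bochner_Integration.integral_sum E_k measure_pmf_single)
  also have "(\<integral>x. indicator (- F) (fst x) * (- ln (pmf a (fst x))) \<partial>?P)
      = (\<integral>g. indicator (- F) g * (- ln (pmf a g)) \<partial>measure_pmf a)"
    by (rule integral_pair_fst)
  finally show ?thesis unfolding kL .
qed

text \<open>Bayes' formula in integrated form: weighting the law of the sum by the posterior probability of
  the first increment \<open>k\<close> gives the law of the sum restricted to that increment.\<close>

lemma nn_integral_bayes:
  fixes a b :: "'g :: group_add pmf" and F :: "'g \<Rightarrow> ennreal"
  shows "(\<integral>\<^sup>+ u. ennreal (pmf a k * pmf b (- k + u) / pmf (conv_pmf a b) u) * F u \<partial>measure_pmf (conv_pmf a b))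
    = ennreal (pmf a k) * (\<integral>\<^sup>+ h. F (k + h) \<partial>measure_pmf b)"
proof -
  let ?r = "conv_pmf a b"
  have cancel: "pmf ?r u * (pmf a k * pmf b (- k + u) / pmf ?r u) = pmf a k * pmf b (- k + u)" for u
  proof (cases "pmf ?r u = 0")
    case True
    have "pmf a k * pmf b (- k + u) \<le> pmf ?r u"
      using conditional_prob_bounds(3)[of a k b "- k + u"] by (simp add: add.assoc[symmetric])
    moreover have "0 \<le> pmf a k * pmf b (- k + u)" by simp
    ultimately show ?thesis using True by simp
  qed simp
  have "(\<integral>\<^sup>+ u. ennreal (pmf a k * pmf b (- k + u) / pmf ?r u) * F u \<partial>measure_pmf ?r)
      = (\<integral>\<^sup>+ u. ennreal (pmf ?r u * (pmf a k * pmf b (- k + u) / pmf ?r u)) * F u \<partial>count_space UNIV)"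
    unfolding nn_integral_measure_pmf
    by (intro nn_integral_cong) (simp only: ennreal_mult' pmf_nonneg mult.assoc)
  also have "\<dots> = (\<integral>\<^sup>+ u. ennreal (pmf a k) * (ennreal (pmf b (- k + u)) * F u) \<partial>count_space UNIV)"
    unfolding cancel by (simp add: ennreal_mult' mult.assoc)
  also have "\<dots> = (\<integral>\<^sup>+ h. ennreal (pmf a k) * (ennreal (pmf b (- k + (k + h))) * F (k + h)) \<partial>count_space UNIV)"
    by (rule nn_integral_count_space_translate[symmetric])
  also have "\<dots> = ennreal (pmf a k) * (\<integral>\<^sup>+ h. F (k + h) \<partial>measure_pmf b)"
    by (simp add: nn_integral_cmult nn_integral_measure_pmf add.assoc[symmetric])
  finally show ?thesis .
qed

section \<open>Reverse martingales with trivial tail\<close>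

lemma measurable_finer:
  assumes "f \<in> N \<rightarrow>\<^sub>M K" and "space N = space M" and "sets N \<subseteq> sets M"
  shows "f \<in> M \<rightarrow>\<^sub>M K"
proof (rule measurableI)
  show "x \<in> space M \<Longrightarrow> f x \<in> space K" for x
    using measurable_space[OF assms(1), of x] by (simp add: assms(2))
  show "A \<in> sets K \<Longrightarrow> f -` A \<inter> space M \<in> sets M" for A
    using measurable_sets[OF assms(1), of A] assms(3) unfolding assms(2) by (rule rev_subsetD)
qed

text \<open>The identity \<open>orth\<close> is what remains of the reverse martingale property. It makes
  \<open>E (Z\<^sub>n - Z\<^sub>m)\<^sup>2\<close> the difference of the decreasing second moments, so a subsequence along which these
  converge fast has almost surely summable increments and converges almost surely. Its upper
  limit does not depend on finitely many terms, hence is measurable for every \<open>G n\<close> and almost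
  surely constant by triviality; the constant must be the common mean.\<close>

lemma (in prob_space) reverse_martingale_second_moment:
  fixes Z :: "nat \<Rightarrow> 'a \<Rightarrow> real" and G :: "nat \<Rightarrow> 'a measure"
  assumes sub: "\<And>n. space (G n) = space M" "\<And>n. sets (G n) \<subseteq> sets M"
    and anti: "\<And>n m. n \<le> m \<Longrightarrow> sets (G m) \<subseteq> sets (G n)"
    and Z_G: "\<And>n. Z n \<in> borel_measurable (G n)"
    and Z01: "\<And>n x. 0 \<le> Z n x" "\<And>n x. Z n x \<le> 1"
    and mean: "\<And>n. expectation (Z n) = c"
    and orth: "\<And>n m. n \<le> m \<Longrightarrow> expectation (\<lambda>x. Z n x * Z m x) = expectation (\<lambda>x. (Z m x)\<^sup>2)"
    and triv: "\<And>A. (\<And>n. A \<in> sets (G n)) \<Longrightarrow> prob A = 0 \<or> prob A = 1"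
  shows "(\<lambda>n. expectation (\<lambda>x. (Z n x)\<^sup>2)) \<longlonglongrightarrow> c\<^sup>2"
proof -
  have meas_up: "f \<in> borel_measurable (G n) \<Longrightarrow> f \<in> borel_measurable (G k)" if "k \<le> n" for f :: "'a \<Rightarrow> 'b :: topological_space" and k n
    by (rule measurable_finer[OF _ _ anti[OF that]]) (simp_all add: sub(1))
  have Z_meas [measurable]: "Z n \<in> borel_measurable M" for n
    by (rule measurable_finer[OF Z_G sub])
  define e where "e n = expectation (\<lambda>x. (Z n x)\<^sup>2)" for n
  have int_ZZ: "integrable M (\<lambda>x. Z n x * Z m x)" for n m
    by (rule integrable_const_bound[where B=1]) (use Z01 in \<open>auto simp: abs_mult mult_le_one\<close>)
  have int_Z: "integrable M (Z n)" for n
    by (rule integrable_const_bound[where B=1]) (use Z01 in auto)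
  have diff: "expectation (\<lambda>x. (Z n x - Z m x)\<^sup>2) = e n - e m" if "n \<le> m" for n m
  proof -
    have "expectation (\<lambda>x. (Z n x - Z m x)\<^sup>2) =
        expectation (\<lambda>x. Z n x * Z n x - 2 * (Z n x * Z m x) + Z m x * Z m x)"
      by (rule Bochner_Integration.integral_cong) (auto simp: power2_eq_square algebra_simps)
    also have "\<dots> = e n - 2 * expectation (\<lambda>x. Z n x * Z m x) + e m"
      using int_ZZ by (simp add: e_def power2_eq_square)
    finally show ?thesis using orth[OF that] by (simp add: e_def)
  qed
  have "decseq e"
    unfolding decseq_def
  proof (intro allI impI)
    fix n m :: nat assume "n \<le> m"
    have "0 \<le> expectation (\<lambda>x. (Z n x - Z m x)\<^sup>2)"
      by (rule Bochner_Integration.integral_nonneg) auto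
    then show "e m \<le> e n" using diff[OF \<open>n \<le> m\<close>] by simp
  qed
  moreover have "0 \<le> e n" for n unfolding e_def by (rule Bochner_Integration.integral_nonneg) auto
  ultimately obtain l where l: "e \<longlonglongrightarrow> l" and l_le: "\<And>n. l \<le> e n"
    using decseq_convergent[of e 0] by blast
  \<comment> \<open>The rate \<open>8\<^sup>-\<^sup>j\<close> beats the factor \<open>2\<^sup>j\<close> that comes from estimating a first by a second moment.\<close>
  have "\<exists>N. \<forall>n\<ge>N. e n \<le> l + (1/8) ^ j" for j :: nat
    using order_tendstoD(2)[OF l, of "l + (1/8) ^ j"] by (auto simp: eventually_sequentially intro: less_imp_le)
  then obtain N where N: "\<And>j n. N j \<le> n \<Longrightarrow> e n \<le> l + (1/8) ^ j" by metis
  define s where "s = rec_nat (N 0) (\<lambda>j m. max (Suc m) (N (Suc j)))"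
  have s_simps: "s 0 = N 0" "s (Suc j) = max (Suc (s j)) (N (Suc j))" for j
    by (simp_all add: s_def)
  have s_mono: "strict_mono s"
    by (rule strict_mono_Suc_iff[THEN iffD2]) (simp add: s_simps less_max_iff_disj)
  have s_N: "N j \<le> s j" for j by (cases j) (auto simp: s_simps)
  have s_ge: "j \<le> s j" for j using s_mono by (rule seq_suble)
  define D where "D j x = \<bar>Z (s j) x - Z (s (Suc j)) x\<bar>" for j x
  have D_meas [measurable]: "D j \<in> borel_measurable M" for j unfolding D_def by measurable
  have D_int: "(\<integral>\<^sup>+ x. ennreal (D j x) \<partial>M) \<le> ennreal ((1/2) ^ j + (1/4) ^ j)" for j
  proof -
    have int_sq: "integrable M (\<lambda>x. (Z (s j) x - Z (s (Suc j)) x)\<^sup>2)"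
    proof (rule integrable_const_bound[where B=1], rule AE_I2)
      fix x
      have "\<bar>Z (s j) x - Z (s (Suc j)) x\<bar> \<le> 1"
        using Z01(1)[of "s j" x] Z01(2)[of "s j" x] Z01(1)[of "s (Suc j)" x] Z01(2)[of "s (Suc j)" x] by linarith
      then show "norm ((Z (s j) x - Z (s (Suc j)) x)\<^sup>2) \<le> 1" by (simp add: abs_square_le_1)
    qed simp
    have int_D: "integrable M (D j)"
      unfolding D_def using int_Z by auto
    have "expectation (D j) \<le> expectation (\<lambda>x. (1/2) ^ j + 2 ^ j * (Z (s j) x - Z (s (Suc j)) x)\<^sup>2)"
    proof (rule integral_mono[OF int_D])
      fix x
      let ?d = "D j x"
      \<comment> \<open>\<open>d \<le> \<delta> + d\<^sup>2 / \<delta>\<close> with \<open>\<delta> = 2\<^sup>-\<^sup>j\<close>\<close>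
      have "0 \<le> (1 - 2 ^ j * ?d)\<^sup>2" by simp
      then have "2 * (2 ^ j * ?d) \<le> 1 + (2 ^ j * ?d)\<^sup>2" by (simp add: power2_eq_square algebra_simps)
      moreover have "0 \<le> 2 ^ j * ?d" by (simp add: D_def)
      ultimately have "2 ^ j * ?d \<le> 1 + (2 ^ j * ?d)\<^sup>2" by linarith
      then have "(1/2) ^ j * (2 ^ j * ?d) \<le> (1/2) ^ j * (1 + (2 ^ j * ?d)\<^sup>2)"
        by (intro mult_left_mono) auto
      then show "D j x \<le> (1/2) ^ j + 2 ^ j * (Z (s j) x - Z (s (Suc j)) x)\<^sup>2"
        by (simp add: D_def power_divide power2_eq_square field_simps)
    qed (use int_sq in auto)
    also have "\<dots> = (1/2) ^ j + 2 ^ j * (e (s j) - e (s (Suc j)))"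
      using int_sq diff[of "s j" "s (Suc j)"] s_simps(2)[of j] by (simp add: prob_space)
    also have "e (s j) - e (s (Suc j)) \<le> (1/8) ^ j"
      using N[OF s_N[of j]] l_le[of "s (Suc j)"] by simp
    also have "2 ^ j * (1/8) ^ j = ((1/4) ^ j :: real)"
      by (simp add: power_mult_distrib[symmetric])
    finally have "expectation (D j) \<le> (1/2) ^ j + (1/4) ^ j" by simp
    moreover have "(\<integral>\<^sup>+ x. ennreal (D j x) \<partial>M) = ennreal (expectation (D j))"
      by (rule nn_integral_eq_integral[OF int_D]) (simp add: D_def)
    ultimately show ?thesis by (simp add: ennreal_leI del: ennreal_plus)
  qed
  have "(\<integral>\<^sup>+ x. (\<Sum>j. ennreal (D j x)) \<partial>M) = (\<Sum>j. \<integral>\<^sup>+ x. ennreal (D j x) \<partial>M)"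
    by (rule nn_integral_suminf) auto
  also have "\<dots> \<le> (\<Sum>j. ennreal ((1/2) ^ j + (1/4) ^ j))"
    by (intro suminf_le D_int) auto
  also have "\<dots> < top"
    by (subst suminf_ennreal2) (auto intro!: summable_add)
  finally have "AE x in M. (\<Sum>j. ennreal (D j x)) \<noteq> top"
    by (intro nn_integral_PInf_AE[unfolded infinity_ennreal_def]) auto
  then have AE_conv: "AE x in M. convergent (\<lambda>j. Z (s j) x)"
  proof eventually_elim
    case (elim x)
    have "summable (\<lambda>j. D j x)"
      by (rule summable_suminf_not_top) (use elim in \<open>auto simp: D_def\<close>)
    then have "summable (\<lambda>j. Z (s (Suc j)) x - Z (s j) x)"
      unfolding D_def by (subst (asm) abs_minus_commute) (rule summable_rabs_cancel)
    moreover have "(\<Sum>j<n. Z (s (Suc j)) x - Z (s j) x) = Z (s n) x - Z (s 0) x" for n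
      by (rule sum_lessThan_telescope[of "\<lambda>j. Z (s j) x"])
    ultimately have "convergent (\<lambda>n. (Z (s n) x - Z (s 0) x) + Z (s 0) x)"
      by (intro convergent_add convergent_const) (simp add: summable_iff_convergent)
    then show ?case by simp
  qed
  define W where "W x = real_of_ereal (limsup (\<lambda>j. ereal (Z (s j) x)))" for x
  have W_G: "W \<in> borel_measurable (G k)" for k
  proof -
    have "(\<lambda>x. ereal (Z (s (j + k)) x)) \<in> borel_measurable (G k)" for j
      using meas_up[OF order_trans[OF le_add2 s_ge[of "j + k"]] Z_G] by simp
    then have "(\<lambda>x. real_of_ereal (limsup (\<lambda>j. ereal (Z (s (j + k)) x)))) \<in> borel_measurable (G k)"
      by measurable
    moreover have "limsup (\<lambda>j. ereal (Z (s (j + k)) x)) = limsup (\<lambda>j. ereal (Z (s j) x))" for x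
      by (rule limsup_shift_k)
    ultimately show ?thesis unfolding W_def[abs_def] by simp
  qed
  have W_meas [measurable]: "W \<in> borel_measurable M"
    by (rule measurable_finer[OF W_G sub])
  have AE_W: "AE x in M. (\<lambda>j. Z (s j) x) \<longlonglongrightarrow> W x"
    using AE_conv
  proof eventually_elim
    case (elim x)
    then obtain w where w: "(\<lambda>j. Z (s j) x) \<longlonglongrightarrow> w" by (auto simp: convergent_def)
    then have "(\<lambda>j. ereal (Z (s j) x)) \<longlonglongrightarrow> ereal w" by simp
    then have "limsup (\<lambda>j. ereal (Z (s j) x)) = ereal w"
      by (rule lim_imp_Limsup[OF trivial_limit_sequentially])
    with w show ?case by (simp add: W_def)
  qed
  have int_W: "integrable M W" and "(\<lambda>j. expectation (Z (s j))) \<longlonglongrightarrow> expectation W"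
    using Z01 AE_W
    by (auto intro!: integrable_dominated_convergence[where w="\<lambda>_. 1" and s="\<lambda>j. Z (s j)"]
        integral_dominated_convergence[where w="\<lambda>_. 1"])
  then have E_W: "expectation W = c"
    by (simp add: mean LIMSEQ_const_iff)
  have "{x \<in> space M. c \<le> W x} \<in> sets (G n)" for n
    using W_G[of n] sub(1)[of n, symmetric] by simp
  then have "prob {x \<in> space M. c \<le> W x} = 0 \<or> prob {x \<in> space M. c \<le> W x} = 1"
    by (rule triv)
  then have AE_c: "AE x in M. W x = c"
  proof
    assume "prob {x \<in> space M. c \<le> W x} = 1"
    then have "AE x in M. x \<in> {x \<in> space M. c \<le> W x}"
      by (subst (asm) prob_eq_1) auto
    then have "AE x in M. 0 \<le> W x - c" by eventually_elim simp
    moreover have "expectation (\<lambda>x. W x - c) = 0"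
      using int_W E_W by (simp add: prob_space)
    ultimately have "AE x in M. W x - c = 0"
      using int_W by (subst (asm) integral_nonneg_eq_0_iff_AE) auto
    then show ?thesis by eventually_elim simp
  next
    assume "prob {x \<in> space M. c \<le> W x} = 0"
    then have lt: "AE x in M. 0 < c - W x"
      by (subst (asm) prob_eq_0) (auto simp: not_le)
    have "expectation (\<lambda>x. c - W x) = 0"
      using int_W E_W by (simp add: prob_space)
    moreover have "AE x in M. 0 \<le> c - W x" using lt by eventually_elim simp
    ultimately have "AE x in M. c - W x = 0"
      using int_W by (subst (asm) integral_nonneg_eq_0_iff_AE) auto
    then show ?thesis by eventually_elim simp
  qed
  have "(\<lambda>j. expectation (\<lambda>x. (Z (s j) x)\<^sup>2)) \<longlonglongrightarrow> expectation (\<lambda>x. c\<^sup>2)"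
  proof (rule integral_dominated_convergence[where w="\<lambda>_. 1"])
    show "AE x in M. (\<lambda>j. (Z (s j) x)\<^sup>2) \<longlonglongrightarrow> c\<^sup>2"
      using AE_W AE_c by eventually_elim (auto intro: tendsto_power)
  qed (use Z01 in \<open>auto intro!: power_le_one\<close>)
  then have "(\<lambda>j. e (s j)) \<longlonglongrightarrow> c\<^sup>2" by (simp add: e_def prob_space)
  moreover have "(\<lambda>j. e (s j)) \<longlonglongrightarrow> l"
    using LIMSEQ_subseq_LIMSEQ[OF l s_mono] by (simp add: o_def)
  ultimately have "l = c\<^sup>2" by (rule LIMSEQ_unique[THEN sym])
  with l show ?thesis unfolding e_def by simp
qed

section \<open>Path measures of Markov chains\<close>

text \<open>Paths are studied through their finite prefixes, because the type of lists over a countable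
  type is countable: the law of a prefix is a \<open>pmf\<close>, and events that depend on a prefix are
  handled by summation.\<close>

locale markov_path =
  fixes x0 :: "'g :: countable" and K :: "nat \<Rightarrow> 'g \<Rightarrow> 'g pmf"
begin

interpretation IT: Ionescu_Tulcea "chain_kernel x0 K" "\<lambda>_. count_space UNIV"
  by (rule Ionescu_Tulcea_chain_kernel)

definition P :: "(nat \<Rightarrow> 'g) measure" where "P = chain_path_measure x0 K"

definition prefix :: "nat \<Rightarrow> (nat \<Rightarrow> 'g) \<Rightarrow> 'g list" where
  "prefix n x = map x [0..<Suc n]"

fun prefix_pmf :: "nat \<Rightarrow> 'g list pmf" where
  "prefix_pmf 0 = return_pmf [x0]"
| "prefix_pmf (Suc n) = bind_pmf (prefix_pmf n) (\<lambda>l. map_pmf (\<lambda>z. l @ [z]) (K n (last l)))"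

lemma P_eq: "P = IT.PF.lim"
  unfolding P_def chain_path_measure_def ..

lemma sets_P [measurable_cong]: "sets P = sets (PiM UNIV (\<lambda>_. count_space UNIV))"
  unfolding P_eq by (rule IT.PF.sets_lim)

lemma space_P [simp]: "space P = UNIV"
  using sets_eq_imp_space_eq[OF sets_P] by (simp add: space_PiM)

lemma coordinate_measurable [measurable]: "(\<lambda>x. x i) \<in> P \<rightarrow>\<^sub>M count_space UNIV"
  unfolding measurable_cong_sets[OF sets_P refl] by (rule measurable_component_singleton) simp

lemma prefix_vimage:
  assumes "length l = Suc n"
  shows "prefix n -` {l} = {x. \<forall>i<Suc n. x i = l ! i}"
proof -
  have "prefix n x = l \<longleftrightarrow> (\<forall>i<Suc n. x i = l ! i)" for x
    using assms by (simp add: prefix_def list_eq_iff_nth_eq del: upt_Suc)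
  then show ?thesis by (simp add: vimage_def)
qed

lemma measurable_prefix [measurable]: "prefix n \<in> P \<rightarrow>\<^sub>M count_space UNIV"
proof -
  have "prefix n -` {l} \<inter> space P \<in> sets P" for l
  proof (cases "length l = Suc n")
    case True
    have "{x \<in> space P. \<forall>i\<in>{..<Suc n}. x i = l ! i} \<in> sets P" by measurable
    then show ?thesis by (simp add: prefix_vimage[OF True] Ball_def del: all_simps)
  next
    case False
    then have "prefix n -` {l} = {}" by (auto simp: prefix_def)
    then show ?thesis by simp
  qed
  then show ?thesis by (simp add: measurable_count_space_eq2_countable)
qed

text \<open>The number \<open>w n\<close> is the mass that the Ionescu-Tulcea construction gives to a single initial
  segment; one application of the kernel multiplies it by one transition probability.\<close>

lemma emeasure_cylinder:
  fixes a :: "nat \<Rightarrow> 'g"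
  defines "w \<equiv> \<lambda>n. emeasure (IT.C 0 n (\<lambda>_. undefined)) {restrict a {0..<n}}"
  shows "w 0 = 1"
    and "w (Suc n) = w n * emeasure (chain_kernel x0 K n (restrict a {0..<n})) {a n}"
    and "emeasure P {x. \<forall>i<n. x i = a i} = w n"
proof -
  have sing: "{restrict a {0..<m}} = PiE {0..<m} (\<lambda>i. {a i})" for m
  proof -
    have "PiE {0..<m} (\<lambda>i. {a i}) = PiE {0..<m} (\<lambda>i. {restrict a {0..<m} i})"
      by (rule PiE_cong) simp
    also have "\<dots> = {restrict a {0..<m}}"
      by (rule PiE_singleton) (rule restrict_extensional)
    finally show ?thesis by simp
  qed
  have meas [measurable]: "{restrict a {0..<m}} \<in> sets (PiM {0..<m} (\<lambda>_. count_space UNIV))" for m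
    unfolding sing by (rule sets_PiM_I_finite) auto
  have undef: "(\<lambda>_. undefined) \<in> space (PiM {0..<0::nat} (\<lambda>_. count_space (UNIV::'g set)))"
    by (simp add: space_PiM)
  show "w 0 = 1"
    unfolding w_def IT.C.simps by (subst emeasure_return[OF meas]) (simp add: restrict_def)
  show "w (Suc n) = w n * emeasure (chain_kernel x0 K n (restrict a {0..<n})) {a n}"
  proof -
    have eP: "IT.eP n \<in> IT.C 0 n (\<lambda>_. undefined) \<rightarrow>\<^sub>M subprob_algebra (PiM {0..<Suc n} (\<lambda>_. count_space UNIV))"
      using IT.measurable_eP[of n] by (simp only: measurable_cong_sets[OF IT.sets_C[OF undef] refl] add_0)
    have "w (Suc n) = (\<integral>\<^sup>+ y. emeasure (IT.eP n y) {restrict a {0..<Suc n}} \<partial>IT.C 0 n (\<lambda>_. undefined))"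
      unfolding w_def IT.C.simps add_0
      by (rule emeasure_bind[OF _ eP meas]) (rule prob_space.not_empty[OF IT.prob_space_C[OF undef]])
    also have "\<dots> = (\<integral>\<^sup>+ y. emeasure (chain_kernel x0 K n (restrict a {0..<n})) {a n} * indicator {restrict a {0..<n}} y \<partial>IT.C 0 n (\<lambda>_. undefined))"
    proof (rule nn_integral_cong)
      fix y assume "y \<in> space (IT.C 0 n (\<lambda>_. undefined))"
      then have y: "y \<in> space (PiM {0..<n} (\<lambda>_. count_space UNIV))"
        by (simp add: IT.space_C[OF undef])
      then have ext: "y \<in> extensional {0..<n}" by (simp add: space_PiM PiE_def)
      have "(\<lambda>z. y(n := z)) -` {restrict a {0..<Suc n}} = (if y = restrict a {0..<n} then {a n} else {})"
      proof -
        have upd: "y(n := z) = restrict a {0..<Suc n} \<longleftrightarrow> y = restrict a {0..<n} \<and> z = a n" for z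
        proof safe
          assume eq: "y(n := z) = restrict a {0..<Suc n}"
          show "z = a n" using fun_cong[OF eq, of n] by simp
          show "y = restrict a {0..<n}"
          proof
            fix i show "y i = restrict a {0..<n} i"
              using fun_cong[OF eq, of i] ext by (cases "i < n") (auto simp: extensional_def)
          qed
        qed (auto simp: fun_eq_iff)
        show ?thesis
          unfolding vimage_def singleton_iff upd by (cases "y = restrict a {0..<n}") simp_all
      qed
      then show "emeasure (IT.eP n y) {restrict a {0..<Suc n}} =
          emeasure (chain_kernel x0 K n (restrict a {0..<n})) {a n} * indicator {restrict a {0..<n}} y"
        by (subst IT.emeasure_eP[OF y meas]) (simp add: indicator_def)
    qed
    also have "\<dots> = emeasure (chain_kernel x0 K n (restrict a {0..<n})) {a n} * w n"
      unfolding w_def by (rule nn_integral_cmult_indicator) (simp only: IT.sets_C[OF undef] meas add_0)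
    finally show ?thesis by (simp only: mult.commute)
  qed
  have "restrict x {0..<n} = restrict a {0..<n} \<longleftrightarrow> (\<forall>i<n. x i = a i)" for x
    by (metis atLeastLessThan_iff restrict_apply' restrict_ext zero_le)
  then have "{x. \<forall>i<n. x i = a i} = IT.PF.emb UNIV {0..<n} {restrict a {0..<n}}"
    by (simp add: prod_emb_def vimage_def)
  then have "emeasure P {x. \<forall>i<n. x i = a i} = emeasure (IT.CI {0..<n}) {restrict a {0..<n}}"
    unfolding P_eq by (simp only: IT.lim[OF finite_atLeastLessThan meas])
  also have "\<dots> = emeasure (IT.C 0 n (\<lambda>_. undefined)) (IT.PF.emb {0..<n} {0..<n} {restrict a {0..<n}})"
    by (rule IT.emeasure_CI[OF subset_refl meas])
  also have "IT.PF.emb {0..<n} {0..<n} {restrict a {0..<n}} = {restrict a {0..<n}}"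
    by (rule prod_emb_id) (simp add: PiE_def)
  finally show "emeasure P {x. \<forall>i<n. x i = a i} = w n"
    unfolding w_def .
qed

lemma prob_space_P: "prob_space P"
proof
  show "emeasure P (space P) = 1"
    using emeasure_cylinder(1)[where a="\<lambda>_. x0"] emeasure_cylinder(3)[where n=0 and a="\<lambda>_. x0"] by simp
qed

sublocale P: prob_space P
  by (rule prob_space_P)

lemma pmf_prefix_snoc:
  assumes "length l = Suc n"
  shows "pmf (prefix_pmf (Suc n)) (l @ [z]) = pmf (prefix_pmf n) l * pmf (K n (last l)) z"
proof -
  have "ennreal (pmf (prefix_pmf (Suc n)) (l @ [z])) =
      (\<integral>\<^sup>+ m. ennreal (pmf (K n (last l)) z) * indicator {l} m \<partial>measure_pmf (prefix_pmf n))"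
    unfolding prefix_pmf.simps ennreal_pmf_bind
  proof (rule nn_integral_cong)
    fix m
    have "pmf (map_pmf (\<lambda>z. l @ [z]) (K n (last l))) (l @ [z]) = pmf (K n (last l)) z"
      by (rule pmf_map_inj') (auto simp: inj_def)
    moreover have "pmf (map_pmf (\<lambda>z. m @ [z]) (K n (last m))) (l @ [z]) = 0" if "m \<noteq> l"
      by (rule pmf_map_outside) (use that in auto)
    ultimately show "ennreal (pmf (map_pmf (\<lambda>z. m @ [z]) (K n (last m))) (l @ [z])) =
        ennreal (pmf (K n (last l)) z) * indicator {l} m"
      by (cases "m = l") auto
  qed
  also have "\<dots> = ennreal (pmf (prefix_pmf n) l * pmf (K n (last l)) z)"
    by (subst nn_integral_cmult_indicator) (auto simp: emeasure_pmf_single mult.commute ennreal_mult')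
  finally show ?thesis by (simp add: ennreal_inj)
qed

lemma emeasure_prefix: "emeasure P (prefix n -` {l}) = ennreal (pmf (prefix_pmf n) l)"
proof (cases "length l = Suc n")
  case False
  have "length l' = Suc n" if "l' \<in> set_pmf (prefix_pmf n)" for l'
    using that by (induction n arbitrary: l') auto
  with False have "pmf (prefix_pmf n) l = 0" by (auto simp: set_pmf_iff)
  moreover have "prefix n -` {l} = {}" using False by (auto simp: prefix_def)
  ultimately show ?thesis by simp
next
  case True
  then show ?thesis
  proof (induction n arbitrary: l)
    case 0
    then obtain z where l: "l = [z]" by (auto simp: length_Suc_conv)
    have "emeasure P (prefix 0 -` {l}) = emeasure (chain_kernel x0 K 0 (restrict ((!) l) {0..<0})) {l ! 0}"
      unfolding prefix_vimage[OF 0] emeasure_cylinder(3) by (simp only: emeasure_cylinder(1,2) mult_1)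
    then show ?case by (simp add: l chain_kernel_def emeasure_pmf_single indicator_def)
  next
    case (Suc n)
    from Suc.prems obtain l' z where l: "l = l' @ [z]" by (cases l rule: rev_cases) auto
    with Suc.prems have len: "length l' = Suc n" by simp
    have "emeasure P (prefix (Suc n) -` {l}) = emeasure P {x. \<forall>i<Suc n. x i = l ! i} *
        emeasure (chain_kernel x0 K (Suc n) (restrict ((!) l) {0..<Suc n})) {l ! Suc n}"
      unfolding prefix_vimage[OF Suc.prems] emeasure_cylinder(3) by (rule emeasure_cylinder(2))
    also have "{x. \<forall>i<Suc n. x i = l ! i} = prefix n -` {l'}"
      unfolding prefix_vimage[OF len] using len by (auto simp: l nth_append)
    also have "emeasure (chain_kernel x0 K (Suc n) (restrict ((!) l) {0..<Suc n})) {l ! Suc n} = ennreal (pmf (K n (last l')) z)"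
      using len by (simp add: chain_kernel_def emeasure_pmf_single l nth_append last_conv_nth)
        (metis lessI last_conv_nth diff_Suc_1 length_0_conv nat.distinct(1))
    finally have *: "emeasure P (prefix (Suc n) -` {l}) = ennreal (pmf (prefix_pmf n) l') * ennreal (pmf (K n (last l')) z)"
      using Suc.IH[OF len] by simp
    then show ?case
      unfolding l pmf_prefix_snoc[OF len] by (simp add: ennreal_mult')
  qed
qed

lemma distr_prefix: "distr P (count_space UNIV) (prefix n) = measure_pmf (prefix_pmf n)"
  by (rule measure_eqI_countable[where A=UNIV])
    (auto simp: emeasure_distr emeasure_prefix emeasure_pmf_single)

lemma integral_prefix:
  fixes f :: "'g list \<Rightarrow> real"
  shows "(\<integral>x. f (prefix n x) \<partial>P) = (\<integral>l. f l \<partial>measure_pmf (prefix_pmf n))"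
  unfolding distr_prefix[symmetric] by (rule integral_distr[symmetric]) auto

lemma measure_prefix: "measure P (prefix n -` L) = measure (measure_pmf (prefix_pmf n)) L"
  unfolding distr_prefix[symmetric] by (subst measure_distr) auto

definition future :: "nat \<Rightarrow> (nat \<Rightarrow> 'g) set set" where
  "future n = sigma_sets UNIV (\<Union>i\<in>{n..}. sets (vimage_algebra UNIV (\<lambda>x. x i) (count_space UNIV)))"

lemma tail_events_iff:
  "A \<in> P.tail_events (\<lambda>n. sets (vimage_algebra UNIV (\<lambda>x. x n) (count_space UNIV))) \<longleftrightarrow> (\<forall>n. A \<in> future n)"
  by (simp add: P.tail_events_def future_def)

lemma coordinate_sets: "sets (vimage_algebra UNIV (\<lambda>x. x i) (count_space UNIV)) = range (\<lambda>S. {x :: nat \<Rightarrow> 'g. x i \<in> S})"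
  by (simp add: sets_vimage_algebra2 vimage_def full_SetCompr_eq)

lemma sigma_sets_subset_P: "W \<subseteq> sets P \<Longrightarrow> sigma_sets UNIV W \<subseteq> sets P"
  using sets.sigma_sets_subset[of W P] by simp

lemma future_sets: "A \<in> future n \<Longrightarrow> A \<in> sets P"
proof -
  assume "A \<in> future n"
  moreover have "future n \<subseteq> sets P"
    unfolding future_def
  proof (rule sigma_sets_subset_P)
    show "(\<Union>i\<in>{n..}. sets (vimage_algebra UNIV (\<lambda>x. x i) (count_space UNIV))) \<subseteq> sets P"
      unfolding coordinate_sets
    proof safe
      fix i S
      have "{x \<in> space P. x i \<in> S} \<in> sets P" by measurable
      then show "{x. x i \<in> S} \<in> sets P" by simp
    qed
  qed
  ultimately show ?thesis by blast
qed

lemma future_antimono: "n \<le> m \<Longrightarrow> future m \<subseteq> future n"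
  unfolding future_def by (rule sigma_sets_mono', rule UN_mono) auto

text \<open>Finite windows of the future form an intersection-stable generator.\<close>

definition window :: "nat \<Rightarrow> nat \<Rightarrow> (nat \<Rightarrow> 'g set) \<Rightarrow> (nat \<Rightarrow> 'g) set" where
  "window n L S = {x. \<forall>i<L. x (n + i) \<in> S (n + i)}"

definition windows :: "nat \<Rightarrow> (nat \<Rightarrow> 'g) set set" where
  "windows n = {window n L S | L S. True}"

lemma Int_stable_windows: "Int_stable (windows n)"
proof (rule Int_stableI)
  fix A B assume "A \<in> windows n" "B \<in> windows n"
  then obtain L S L' S' where A: "A = window n L S" and B: "B = window n L' S'"
    by (auto simp: windows_def)
  have "A \<inter> B = window n (max L L') (\<lambda>j. {y. (j < n + L \<longrightarrow> y \<in> S j) \<and> (j < n + L' \<longrightarrow> y \<in> S' j)})"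
    unfolding A B window_def by (auto simp: less_max_iff_disj)
  then show "A \<inter> B \<in> windows n" unfolding windows_def by blast
qed

lemma future_subset_windows: "future n \<subseteq> sigma_sets UNIV (windows n)"
  unfolding future_def
proof (rule sigma_sets_mono, safe)
  fix i and A :: "(nat \<Rightarrow> 'g) set"
  assume i: "n \<le> i" "A \<in> sets (vimage_algebra UNIV (\<lambda>x. x i) (count_space UNIV))"
  then obtain S where A: "A = {x. x i \<in> S}" unfolding coordinate_sets by auto
  have "A = window n (Suc (i - n)) (\<lambda>j. if j = i then S else UNIV)"
    using i(1) unfolding A window_def by (auto simp: less_Suc_eq_le dest: spec[of _ "i - n"])
  then have "A \<in> windows n" unfolding windows_def by blast
  then show "A \<in> sigma_sets UNIV (windows n)" ..
qed

lemma window_sets [measurable]: "window n L S \<in> sets P"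
proof -
  have "{x \<in> space P. \<forall>i\<in>{..<L}. x (n + i) \<in> S (n + i)} \<in> sets P" by measurable
  then show ?thesis by (simp add: window_def Ball_def)
qed

lemma prefix_sets [measurable]: "prefix n -` L \<in> sets P"
  using measurable_sets[OF measurable_prefix, of L n] by simp

text \<open>\<open>hit S L n y\<close> is the probability that a chain which is at \<open>y\<close> at time \<open>n\<close> stays in the prescribed
  sets during the window of length \<open>L\<close> starting at time \<open>n\<close>.\<close>

fun hit :: "(nat \<Rightarrow> 'g set) \<Rightarrow> nat \<Rightarrow> nat \<Rightarrow> 'g \<Rightarrow> ennreal" where
  "hit S 0 n y = 1"
| "hit S (Suc L) n y = indicator (S n) y * (\<integral>\<^sup>+ z. hit S L (Suc n) z \<partial>measure_pmf (K n y))"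

lemma emeasure_window_prefix:
  assumes "length l = Suc n"
  shows "emeasure P (window n L S \<inter> prefix n -` {l}) = ennreal (pmf (prefix_pmf n) l) * hit S L n (last l)"
  using assms
proof (induction L arbitrary: n l)
  case 0
  show ?case by (simp add: window_def emeasure_prefix)
next
  case (Suc L)
  have last_x: "x n = last l" if "prefix n x = l" for x
    using that[symmetric] by (simp add: prefix_def)
  have eq: "window n (Suc L) S \<inter> prefix n -` {l} =
      (if last l \<in> S n then (\<Union>z. window (Suc n) L S \<inter> prefix (Suc n) -` {l @ [z]}) else {})"
  proof -
    have "x \<in> window n (Suc L) S \<longleftrightarrow> x n \<in> S n \<and> x \<in> window (Suc n) L S" for x
      unfolding window_def by (auto simp: less_Suc_eq_0_disj)
    moreover have "prefix (Suc n) x = l @ [z] \<longleftrightarrow> prefix n x = l \<and> x (Suc n) = z" for x z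
      by (simp add: prefix_def)
    ultimately show ?thesis using last_x by (auto split: if_splits)
  qed
  show ?case
  proof (cases "last l \<in> S n")
    case False
    then show ?thesis unfolding eq by simp
  next
    case True
    have "emeasure P (window n (Suc L) S \<inter> prefix n -` {l}) =
        (\<integral>\<^sup>+ z. emeasure P (window (Suc n) L S \<inter> prefix (Suc n) -` {l @ [z]}) \<partial>count_space UNIV)"
      unfolding eq if_P[OF True]
      by (rule emeasure_UN_countable) (auto simp: disjoint_family_on_def)
    also have "\<dots> = (\<integral>\<^sup>+ z. ennreal (pmf (prefix_pmf n) l) * (ennreal (pmf (K n (last l)) z) * hit S L (Suc n) z) \<partial>count_space UNIV)"
      by (intro nn_integral_cong)
        (simp add: Suc.IH Suc.prems pmf_prefix_snoc ennreal_mult' mult.assoc del: prefix_pmf.simps)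
    also have "\<dots> = ennreal (pmf (prefix_pmf n) l) * (\<integral>\<^sup>+ z. hit S L (Suc n) z \<partial>measure_pmf (K n (last l)))"
      by (simp add: nn_integral_cmult nn_integral_measure_pmf)
    finally show ?thesis using True by simp
  qed
qed

text \<open>The Markov property, in a form without division: two pasts with the same last state have the
  same conditional probability for a future event. For fixed pasts both sides are measures in the
  event, so windows suffice.\<close>

lemma future_conditional:
  assumes A: "A \<in> future n" and l: "length l = Suc n" "length l' = Suc n" "last l = last l'"
  shows "measure P (A \<inter> prefix n -` {l}) * measure P (prefix n -` {l'}) =
    measure P (A \<inter> prefix n -` {l'}) * measure P (prefix n -` {l})"
proof -
  let ?C = "prefix n -` {l}" and ?C' = "prefix n -` {l'}"
  have sub: "sigma_sets UNIV (windows n) \<subseteq> sets P"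
    by (rule sigma_sets_subset_P) (auto simp: windows_def)
  have "windows n \<subseteq> Pow UNIV" by simp
  have "A \<in> sigma_sets UNIV (windows n)" using A future_subset_windows by blast
  from Int_stable_windows \<open>windows n \<subseteq> Pow UNIV\<close> \<open>A \<in> sigma_sets UNIV (windows n)\<close> show ?thesis
  proof (induction A rule: sigma_sets_induct_disjoint)
    case (basic B)
    then obtain L S where B: "B = window n L S" by (auto simp: windows_def)
    have "emeasure P (B \<inter> ?C) * emeasure P ?C' = emeasure P (B \<inter> ?C') * emeasure P ?C"
      using l by (simp add: B emeasure_window_prefix emeasure_prefix mult_ac)
    then show ?case
      by (simp add: P.emeasure_eq_measure ennreal_mult'[symmetric] ennreal_inj)
  next
    case empty
    show ?case by simp
  next
    case (compl B)
    then have "B \<in> sets P" using sub by blast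
    then have diff: "measure P ((UNIV - B) \<inter> prefix n -` {m}) = measure P (prefix n -` {m}) - measure P (B \<inter> prefix n -` {m})" for m
      using P.finite_measure_Diff'[of "prefix n -` {m}" B] by (simp add: Int_commute Diff_eq)
    show ?case unfolding diff using compl by (simp add: algebra_simps)
  next
    case (union B)
    have "(\<lambda>i. measure P (B i \<inter> prefix n -` {m})) sums measure P (\<Union> (range B) \<inter> prefix n -` {m})" for m
    proof -
      have "(\<lambda>i. measure P (B i \<inter> prefix n -` {m})) sums measure P (\<Union>i. B i \<inter> prefix n -` {m})"
      proof (rule P.finite_measure_UNION)
        have "B i \<in> sets P" for i using union sub by blast
        then show "range (\<lambda>i. B i \<inter> prefix n -` {m}) \<subseteq> sets P" by auto
        show "disjoint_family (\<lambda>i. B i \<inter> prefix n -` {m})"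
          using union by (auto simp: disjoint_family_on_def)
      qed
      then show ?thesis by simp
    qed
    from sums_mult2[OF this[of l], of "measure P ?C'"] sums_mult2[OF this[of l'], of "measure P ?C"]
    show ?case using union.IH by (simp add: sums_unique2)
  qed
qed

text \<open>The function \<open>\<psi>\<close> is the conditional probability of \<open>A\<close> given the state at time \<open>n\<close>. It is read
  off from one chosen past of positive probability that ends in that state; by the Markov property
  the choice is immaterial.\<close>

lemma future_density:
  assumes A: "A \<in> future n"
  obtains \<psi> where "\<And>y. 0 \<le> \<psi> y" "\<And>y. \<psi> y \<le> 1"
    "\<And>L. measure P (A \<inter> prefix n -` L) = (\<integral>l. indicator L l * \<psi> (last l) \<partial>measure_pmf (prefix_pmf n))"
proof -
  have A_sets [measurable]: "A \<in> sets P" using A by (rule future_sets)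
  define good where "good y l \<longleftrightarrow> length l = Suc n \<and> last l = y \<and> measure P (prefix n -` {l}) \<noteq> 0" for y l
  define \<psi> where "\<psi> y = (if \<exists>l. good y l then measure P (A \<inter> prefix n -` {SOME l. good y l}) / measure P (prefix n -` {SOME l. good y l}) else 0)" for y
  have 01: "0 \<le> \<psi> y" "\<psi> y \<le> 1" for y
  proof -
    show "0 \<le> \<psi> y" by (auto simp: \<psi>_def)
    have "measure P (A \<inter> prefix n -` {l}) / measure P (prefix n -` {l}) \<le> 1" for l
      using P.finite_measure_mono[of "A \<inter> prefix n -` {l}" "prefix n -` {l}"]
      by (auto simp: divide_le_eq_1 less_le)
    then show "\<psi> y \<le> 1" by (auto simp: \<psi>_def)
  qed
  have atom: "measure P (A \<inter> prefix n -` {l}) = pmf (prefix_pmf n) l * \<psi> (last l)" for l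
  proof (cases "pmf (prefix_pmf n) l = 0")
    case True
    then have "measure P (prefix n -` {l}) = 0" by (simp add: measure_prefix measure_pmf_single)
    then have "measure P (A \<inter> prefix n -` {l}) = 0"
      using P.finite_measure_mono[of "A \<inter> prefix n -` {l}" "prefix n -` {l}"] measure_nonneg[of P "A \<inter> prefix n -` {l}"] by simp
    then show ?thesis using True by simp
  next
    case False
    then have nz: "measure P (prefix n -` {l}) \<noteq> 0" by (simp add: measure_prefix measure_pmf_single)
    then have "prefix n -` {l} \<noteq> {}" by auto
    then have "length l = Suc n" by (auto simp: prefix_def)
    with nz have g: "good (last l) l" by (simp add: good_def)
    define m where "m = (SOME l'. good (last l) l')"
    have m: "good (last l) m" unfolding m_def using g by (rule someI)
    have "\<psi> (last l) = measure P (A \<inter> prefix n -` {m}) / measure P (prefix n -` {m})"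
      using g by (auto simp: \<psi>_def m_def)
    then have "measure P (prefix n -` {m}) * (measure P (prefix n -` {l}) * \<psi> (last l)) =
        measure P (prefix n -` {m}) * measure P (A \<inter> prefix n -` {l})"
      using future_conditional[OF A, of l m] g m by (simp add: good_def mult_ac)
    then have "measure P (prefix n -` {l}) * \<psi> (last l) = measure P (A \<inter> prefix n -` {l})"
      using m by (simp add: good_def mult_ac)
    then show ?thesis by (simp add: measure_prefix measure_pmf_single)
  qed
  have "measure P (A \<inter> prefix n -` L) = (\<integral>l. indicator L l * \<psi> (last l) \<partial>measure_pmf (prefix_pmf n))" for L
  proof -
    have int: "integrable (measure_pmf (prefix_pmf n)) (\<lambda>l. indicator L l * \<psi> (last l))"
      by (rule measure_pmf.integrable_const_bound[where B=1]) (use 01 in \<open>auto simp: indicator_def\<close>)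
    have "emeasure P (A \<inter> prefix n -` L) = emeasure P (\<Union>l\<in>L. A \<inter> prefix n -` {l})"
      by (rule arg_cong[where f="emeasure P"]) auto
    also have "\<dots> = (\<integral>\<^sup>+ l. emeasure P (A \<inter> prefix n -` {l}) \<partial>count_space L)"
      by (rule emeasure_UN_countable) (auto simp: disjoint_family_on_def)
    also have "\<dots> = (\<integral>\<^sup>+ l. ennreal (pmf (prefix_pmf n) l) * ennreal (indicator L l * \<psi> (last l)) \<partial>count_space UNIV)"
      by (subst nn_integral_count_space_indicator)
        (auto intro!: nn_integral_cong simp: P.emeasure_eq_measure atom ennreal_mult' 01 indicator_def)
    also have "\<dots> = (\<integral>\<^sup>+ l. ennreal (indicator L l * \<psi> (last l)) \<partial>measure_pmf (prefix_pmf n))"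
      by (simp add: nn_integral_measure_pmf)
    also have "\<dots> = ennreal (\<integral>l. indicator L l * \<psi> (last l) \<partial>measure_pmf (prefix_pmf n))"
      by (rule nn_integral_eq_integral[OF int]) (use 01 in auto)
    finally show ?thesis
      by (subst (asm) P.emeasure_eq_measure, subst (asm) ennreal_inj)
        (auto intro!: Bochner_Integration.integral_nonneg simp: 01)
  qed
  with 01 show ?thesis using that by blast
qed

end

section \<open>Walks with independent increments and vanishing information\<close>

definition segment :: "(nat \<Rightarrow> 'g :: group_add pmf) \<Rightarrow> nat \<Rightarrow> nat \<Rightarrow> 'g pmf" where
  "segment \<nu> k n = foldr conv_pmf (map \<nu> [k..<n]) (return_pmf 0)"

lemma segment_self [simp]: "segment \<nu> k k = return_pmf 0"
  by (simp add: segment_def)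

lemma foldr_conv: "foldr conv_pmf ps q = conv_pmf (foldr conv_pmf ps (return_pmf 0)) q"
  by (induction ps) (simp_all add: conv_assoc)

lemma segment_append:
  assumes "k \<le> n" "n \<le> m"
  shows "segment \<nu> k m = conv_pmf (segment \<nu> k n) (segment \<nu> n m)"
proof -
  have "[k..<m] = [k..<n] @ [n..<m]"
    using assms upt_add_eq_append[of k n "m - n"] by simp
  then show ?thesis
    unfolding segment_def by (simp only: map_append foldr_append) (rule foldr_conv)
qed

lemma segment_Suc: "k \<le> n \<Longrightarrow> segment \<nu> k (Suc n) = conv_pmf (segment \<nu> k n) (\<nu> n)"
  using segment_append[of k n "Suc n" \<nu>] by (simp add: segment_def)

lemma segment_Suc_left: "k < n \<Longrightarrow> segment \<nu> k n = conv_pmf (\<nu> k) (segment \<nu> (Suc k) n)"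
  by (simp add: segment_def upt_conv_Cons)

lemma entropy_segment_finite:
  assumes "\<And>i. entropy_pmf (\<nu> i) < top"
  shows "entropy_pmf (segment \<nu> k n) < top"
proof (cases "k \<le> n")
  case True
  then show ?thesis
    by (induction n rule: dec_induct) (simp_all add: segment_Suc entropy_conv_finite assms)
next
  case False
  then show ?thesis by (simp add: segment_def)
qed

locale increment_walk =
  fixes \<nu> :: "nat \<Rightarrow> 'g :: {group_add, countable} pmf"
begin

sublocale markov_path 0 "\<lambda>n g. map_pmf ((+) g) (\<nu> n)" .

lemma length_prefix: "l \<in> set_pmf (prefix_pmf n) \<Longrightarrow> length l = Suc n"
  by (induction n arbitrary: l) auto

lemma law_last: "map_pmf last (prefix_pmf n) = segment \<nu> 0 n"
proof (induction n)
  case (Suc n)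
  have "map_pmf last (prefix_pmf (Suc n)) = bind_pmf (map_pmf last (prefix_pmf n)) (\<lambda>y. map_pmf ((+) y) (\<nu> n))"
    by (simp add: map_bind_pmf map_pmf_comp bind_map_pmf)
  then show ?case by (simp add: Suc segment_Suc conv_pmf_altdef)
qed simp

text \<open>The position at time \<open>n\<close> is the position at time \<open>k\<close> plus an independent increment whose law is
  the convolution over the times between.\<close>

lemma joint_law:
  assumes "k \<le> n"
  shows "map_pmf (\<lambda>l. (l ! k, last l)) (prefix_pmf n) =
    map_pmf (\<lambda>(g, h). (g, g + h)) (pair_pmf (segment \<nu> 0 k) (segment \<nu> k n))"
  using assms
proof (induction n rule: dec_induct)
  case base
  have "map_pmf (\<lambda>l. (l ! k, last l)) (prefix_pmf k) = map_pmf (\<lambda>l. (last l, last l)) (prefix_pmf k)"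
  proof (rule map_pmf_cong[OF refl])
    fix l assume "l \<in> set_pmf (prefix_pmf k)"
    then have "length l = Suc k" by (rule length_prefix)
    then have "l ! k = last l" by (cases l rule: rev_cases) auto
    then show "(l ! k, last l) = (last l, last l)" by simp
  qed
  also have "\<dots> = map_pmf (\<lambda>y. (y, y)) (segment \<nu> 0 k)"
    unfolding law_last[symmetric] by (simp add: map_pmf_comp)
  finally show ?case by (simp add: pair_return_pmf2 map_pmf_comp)
next
  case (step n)
  have "map_pmf (\<lambda>l. (l ! k, last l)) (prefix_pmf (Suc n)) =
      bind_pmf (prefix_pmf n) (\<lambda>l. map_pmf (\<lambda>h. ((l @ [last l + h]) ! k, last l + h)) (\<nu> n))"
    by (simp add: map_bind_pmf map_pmf_comp)
  also have "\<dots> = bind_pmf (prefix_pmf n) (\<lambda>l. map_pmf (\<lambda>h. (l ! k, last l + h)) (\<nu> n))"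
    using step.hyps by (intro bind_pmf_cong refl) (auto dest!: length_prefix simp: nth_append)
  also have "\<dots> = bind_pmf (map_pmf (\<lambda>l. (l ! k, last l)) (prefix_pmf n)) (\<lambda>(g, y). map_pmf (\<lambda>h. (g, y + h)) (\<nu> n))"
    by (simp add: bind_map_pmf)
  also have "\<dots> = map_pmf (\<lambda>(g, h). (g, g + h)) (pair_pmf (segment \<nu> 0 k) (segment \<nu> k (Suc n)))"
    unfolding step.IH segment_Suc[OF step.hyps(1)] conv_pmf_altdef pair_pmf_def
    by (simp only: map_pmf_def bind_assoc_pmf bind_return_pmf prod.case o_def add.assoc)
  finally show ?case .
qed

lemma coordinate_eq_prefix: "k \<le> n \<Longrightarrow> {x. x k = g} = prefix n -` {l. l ! k = g}"
  by (auto simp: prefix_def simp del: upt_Suc)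

lemma last_prefix [simp]: "last (prefix n x) = x n"
  by (simp add: prefix_def)

lemma prob_coordinate: "P.prob {x. x k = g} = pmf (segment \<nu> 0 k) g"
proof -
  have "{x. x k = g} = prefix k -` (last -` {g})" by auto
  then show ?thesis by (simp add: measure_prefix pmf_map law_last[symmetric])
qed

text \<open>For each \<open>n\<close> a tail event is, given the past up to \<open>n\<close>, a function of \<open>x\<^sub>n\<close>, so its covariance
  with the event \<open>x\<^sub>k = g\<close> is bounded by the information between \<open>x\<^sub>k\<close> and \<open>x\<^sub>n\<close>. Letting \<open>n\<close> grow
  leaves only the free parameter \<open>e\<close>.\<close>

lemma tail_correlation_le:
  assumes fin: "\<And>i. entropy_pmf (\<nu> i) < top"
    and lim: "(\<lambda>n. shannon (segment \<nu> 0 n) - shannon (segment \<nu> k n)) \<longlonglongrightarrow> 0"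
    and A: "\<And>n. A \<in> future n"
  shows "P.prob (A \<inter> {x. x k = g}) \<le> pmf (segment \<nu> 0 k) g * P.prob A"
proof (rule field_le_epsilon)
  fix e :: real assume e: "0 < e"
  let ?I = "\<lambda>n. shannon (segment \<nu> 0 n) - shannon (segment \<nu> k n)"
  have "P.prob (A \<inter> {x. x k = g}) - pmf (segment \<nu> 0 k) g * P.prob A \<le> e + ?I n / e" if n: "k \<le> n" for n
  proof -
    obtain \<psi> where \<psi>: "\<And>y. 0 \<le> \<psi> y" "\<And>y. \<psi> y \<le> 1"
      and dens: "\<And>L. P.prob (A \<inter> prefix n -` L) = (\<integral>l. indicator L l * \<psi> (last l) \<partial>measure_pmf (prefix_pmf n))"
      using future_density[OF A[of n]] by blast
    have "P.prob (A \<inter> {x. x k = g}) = (\<integral>l. indicator {l. l ! k = g} l * \<psi> (last l) \<partial>measure_pmf (prefix_pmf n))"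
      unfolding coordinate_eq_prefix[OF n] by (rule dens)
    also have "\<dots> = (\<integral>l. (\<lambda>(u, y). indicator {g} u * \<psi> y) (l ! k, last l) \<partial>measure_pmf (prefix_pmf n))"
      by (simp add: indicator_def)
    also have "\<dots> = (\<integral>(u, y). indicator {g} u * \<psi> y \<partial>measure_pmf (map_pmf (\<lambda>l. (l ! k, last l)) (prefix_pmf n)))"
      by (rule integral_map_pmf[symmetric])
    also have "\<dots> = (\<integral>(u, h). indicator {g} u * \<psi> (u + h) \<partial>measure_pmf (pair_pmf (segment \<nu> 0 k) (segment \<nu> k n)))"
      unfolding joint_law[OF n] integral_map_pmf by (simp add: split_beta')
    finally have 1: "P.prob (A \<inter> {x. x k = g}) =
        (\<integral>(u, h). indicator {g} u * \<psi> (u + h) \<partial>measure_pmf (pair_pmf (segment \<nu> 0 k) (segment \<nu> k n)))" .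
    have 2: "P.prob A = (\<integral>y. \<psi> y \<partial>measure_pmf (segment \<nu> 0 n))"
      using dens[of UNIV] by (simp add: law_last[symmetric])
    have seg: "segment \<nu> 0 n = conv_pmf (segment \<nu> 0 k) (segment \<nu> k n)"
      using n by (intro segment_append) auto
    show ?thesis
      unfolding 1 2 seg
      by (rule correlation_le_information[OF entropy_segment_finite[OF fin] entropy_segment_finite[OF fin] e \<psi>])
  qed
  then have "eventually (\<lambda>n. P.prob (A \<inter> {x. x k = g}) - pmf (segment \<nu> 0 k) g * P.prob A \<le> e + ?I n / e) sequentially"
    by (rule eventually_sequentiallyI)
  moreover have "(\<lambda>n. e + ?I n / e) \<longlonglongrightarrow> e + 0 / e"
    by (intro tendsto_intros lim) (use e in auto)
  ultimately have "P.prob (A \<inter> {x. x k = g}) - pmf (segment \<nu> 0 k) g * P.prob A \<le> e + 0 / e"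
    by (intro tendsto_lowerbound[where F=sequentially]) auto
  then show "P.prob (A \<inter> {x. x k = g}) \<le> pmf (segment \<nu> 0 k) g * P.prob A + e" by simp
qed

lemma future_complement: "A \<in> future n \<Longrightarrow> UNIV - A \<in> future n"
  unfolding future_def by (rule sigma_sets.Compl)

text \<open>Applied to \<open>A\<close> and to its complement, the covariance bound yields independence of \<open>A\<close> from each
  single coordinate \<open>x\<^sub>k\<close>. The Markov property at time \<open>k\<close> upgrades this to the whole past up to \<open>k\<close>,
  so \<open>A\<close> is independent of all finite windows, hence of itself.\<close>

theorem tail_trivial_if_information_vanishes:
  assumes fin: "\<And>i. entropy_pmf (\<nu> i) < top"
    and lim: "\<And>k. (\<lambda>n. shannon (segment \<nu> 0 n) - shannon (segment \<nu> k n)) \<longlonglongrightarrow> 0"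
    and A: "\<And>n. A \<in> future n"
  shows "P.prob A = 0 \<or> P.prob A = 1"
proof -
  have A_sets [measurable]: "A \<in> sets P" using A by (rule future_sets)
  have coord_sets [measurable]: "{x. x k = g} \<in> sets P" for k g
    unfolding coordinate_eq_prefix[OF order_refl] by (rule prefix_sets)
  have coordinate: "P.prob (A \<inter> {x. x k = g}) = pmf (segment \<nu> 0 k) g * P.prob A" for k g
  proof (rule antisym)
    show "P.prob (A \<inter> {x. x k = g}) \<le> pmf (segment \<nu> 0 k) g * P.prob A"
      using fin lim A by (rule tail_correlation_le)
    have "P.prob ((UNIV - A) \<inter> {x. x k = g}) \<le> pmf (segment \<nu> 0 k) g * P.prob (UNIV - A)"
      using fin lim future_complement[OF A] by (rule tail_correlation_le)
    moreover have "P.prob ((UNIV - A) \<inter> {x. x k = g}) = pmf (segment \<nu> 0 k) g - P.prob (A \<inter> {x. x k = g})"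
      using P.finite_measure_Diff'[OF coord_sets[of k g] A_sets]
      by (simp add: prob_coordinate Int_commute Diff_eq)
    moreover have "P.prob (UNIV - A) = 1 - P.prob A"
      using P.prob_compl[OF A_sets] by simp
    ultimately show "pmf (segment \<nu> 0 k) g * P.prob A \<le> P.prob (A \<inter> {x. x k = g})"
      by (simp add: algebra_simps)
  qed
  have past: "P.prob (A \<inter> prefix k -` L) = P.prob A * P.prob (prefix k -` L)" for k L
  proof -
    obtain \<psi> where "\<And>y. 0 \<le> \<psi> y" "\<And>y. \<psi> y \<le> 1"
      and dens: "\<And>L. P.prob (A \<inter> prefix k -` L) = (\<integral>l. indicator L l * \<psi> (last l) \<partial>measure_pmf (prefix_pmf k))"
      using future_density[OF A[of k]] by blast
    have \<psi>_eq: "\<psi> (last l) = P.prob A" if l: "l \<in> set_pmf (prefix_pmf k)" for l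
    proof -
      let ?g = "last l"
      have "?g \<in> set_pmf (segment \<nu> 0 k)"
        unfolding law_last[symmetric] using l by simp
      then have pos: "pmf (segment \<nu> 0 k) ?g > 0" by (rule pmf_positive)
      have "{x. x k = ?g} = prefix k -` (last -` {?g})" by auto
      then have "pmf (segment \<nu> 0 k) ?g * P.prob A = (\<integral>l. indicator (last -` {?g}) l * \<psi> (last l) \<partial>measure_pmf (prefix_pmf k))"
        using coordinate[of k ?g] dens[of "last -` {?g}"] by simp
      also have "\<dots> = (\<integral>l. indicator (last -` {?g}) l * \<psi> ?g \<partial>measure_pmf (prefix_pmf k))"
        by (rule Bochner_Integration.integral_cong) (auto simp: indicator_def)
      also have "\<dots> = pmf (segment \<nu> 0 k) ?g * \<psi> ?g"
        by (simp add: pmf_map law_last[symmetric])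
      finally show ?thesis using pos by simp
    qed
    have "P.prob (A \<inter> prefix k -` L) = (\<integral>l. indicator L l * P.prob A \<partial>measure_pmf (prefix_pmf k))"
      unfolding dens by (rule integral_cong_AE) (auto intro!: AE_pmfI simp: \<psi>_eq)
    also have "\<dots> = P.prob A * P.prob (prefix k -` L)"
      by (simp add: measure_prefix)
    finally show ?thesis .
  qed
  have sub: "sigma_sets UNIV (windows 0) \<subseteq> sets P"
    by (rule sigma_sets_subset_P) (auto simp: windows_def)
  have "windows 0 \<subseteq> Pow UNIV" by simp
  have "B \<in> sigma_sets UNIV (windows 0) \<Longrightarrow> P.prob (A \<inter> B) = P.prob A * P.prob B" for B
  proof -
    assume "B \<in> sigma_sets UNIV (windows 0)"
    from Int_stable_windows \<open>windows 0 \<subseteq> Pow UNIV\<close> this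
    show "P.prob (A \<inter> B) = P.prob A * P.prob B"
    proof (induction B rule: sigma_sets_induct_disjoint)
      case (basic B)
      then obtain L S where "B = window 0 L S" by (auto simp: windows_def)
      also have "\<dots> = prefix L -` {l. \<forall>i<L. l ! i \<in> S i}"
        by (auto simp: window_def prefix_def simp del: upt_Suc)
      finally show ?case by (simp only: past)
    next
      case empty
      show ?case by simp
    next
      case (compl B)
      then have [measurable]: "B \<in> sets P" using sub by blast
      have "P.prob (A \<inter> (UNIV - B)) = P.prob A - P.prob (A \<inter> B)"
        using P.finite_measure_Diff'[of A B] by (simp add: Diff_eq)
      moreover have "P.prob (UNIV - B) = 1 - P.prob B"
        using P.prob_compl[of B] by simp
      ultimately show ?case using compl.IH by (simp only: right_diff_distrib mult_1_right)
    next
      case (union B)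
      have B: "B i \<in> sets P" for i using union sub by blast
      have "(\<lambda>i. P.prob (A \<inter> B i)) sums P.prob (\<Union>i. A \<inter> B i)"
        by (rule P.finite_measure_UNION) (use B union in \<open>auto simp: disjoint_family_on_def\<close>)
      moreover have "(\<lambda>i. P.prob A * P.prob (B i)) sums (P.prob A * P.prob (\<Union>i. B i))"
        by (intro sums_mult P.finite_measure_UNION) (use B union in auto)
      ultimately show ?case
        using union.IH by (simp add: sums_unique2)
    qed
  qed
  from this[of A] have "P.prob A = P.prob A * P.prob A"
    using A[of 0] future_subset_windows by auto
  then show ?thesis by simp
qed

end

section \<open>Trivial tail forces the information to vanish\<close>

context increment_walk
begin

lemma integral_coordinate:
  fixes f :: "'g \<Rightarrow> real"
  shows "(\<integral>x. f (x n) \<partial>P) = (\<integral>y. f y \<partial>measure_pmf (segment \<nu> 0 n))"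
  using integral_prefix[of "\<lambda>l. f (last l)" n] by (simp add: law_last[symmetric])

lemma integral_two_coordinates:
  fixes f :: "'g \<Rightarrow> 'g \<Rightarrow> real"
  assumes "k \<le> n"
  shows "(\<integral>x. f (x k) (x n) \<partial>P) = (\<integral>(g, h). f g (g + h) \<partial>measure_pmf (pair_pmf (segment \<nu> 0 k) (segment \<nu> k n)))"
proof -
  have nth: "prefix n x ! k = x k" for x
    using assms by (simp add: prefix_def del: upt_Suc)
  have "(\<integral>x. f (x k) (x n) \<partial>P) = (\<integral>l. f (l ! k) (last l) \<partial>measure_pmf (prefix_pmf n))"
    using integral_prefix[of "\<lambda>l. f (l ! k) (last l)" n] by (simp add: nth)
  also have "\<dots> = (\<integral>x. f (fst x) (snd x) \<partial>measure_pmf (map_pmf (\<lambda>l. (l ! k, last l)) (prefix_pmf n)))"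
    by simp
  also have "\<dots> = (\<integral>(g, h). f g (g + h) \<partial>measure_pmf (pair_pmf (segment \<nu> 0 k) (segment \<nu> k n)))"
    unfolding joint_law[OF assms] integral_map_pmf by (simp add: split_beta')
  finally show ?thesis .
qed

text \<open>The conditional probability that the first increment is \<open>k\<close>, given \<open>x\<^sub>n = y\<close>; meaningful for
  \<open>n \<ge> 1\<close>.\<close>

definition first_step_posterior :: "'g \<Rightarrow> nat \<Rightarrow> 'g \<Rightarrow> real" where
  "first_step_posterior k n y = pmf (\<nu> 0) k * pmf (segment \<nu> 1 n) (- k + y) / pmf (segment \<nu> 0 n) y"

lemma segment_first: "1 \<le> n \<Longrightarrow> segment \<nu> 0 n = conv_pmf (\<nu> 0) (segment \<nu> 1 n)"
  using segment_Suc_left[of 0 n \<nu>] by simp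

lemma posterior_bounds:
  assumes "1 \<le> n"
  shows "0 \<le> first_step_posterior k n y" "first_step_posterior k n y \<le> 1"
  unfolding first_step_posterior_def segment_first[OF assms]
  by (rule conditional_prob_bounds)+

text \<open>Weighting by the posterior at time \<open>n\<close> amounts to conditioning the first increment to be \<open>k\<close>;
  what is left of the walk between \<open>n\<close> and \<open>m\<close> is unaffected, so the same weight can be expressed by
  the posterior at the later time \<open>m\<close>. Bayes' formula is used once in each direction.\<close>

lemma posterior_orthogonality:
  assumes "1 \<le> n" "n \<le> m"
  shows "(\<integral>x. first_step_posterior k n (x n) * first_step_posterior k m (x m) \<partial>P) =
    (\<integral>x. (first_step_posterior k m (x m))\<^sup>2 \<partial>P)"
proof -
  have m: "1 \<le> m" using assms by simp
  let ?M = "first_step_posterior k"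
  note bd = posterior_bounds[OF assms(1)] posterior_bounds[OF m]
  have bayes: "(\<integral>\<^sup>+ u. ennreal (?M j u) * F u \<partial>measure_pmf (segment \<nu> 0 j))
      = ennreal (pmf (\<nu> 0) k) * (\<integral>\<^sup>+ h. F (k + h) \<partial>measure_pmf (segment \<nu> 1 j))" if "1 \<le> j" for j F
    unfolding first_step_posterior_def segment_first[OF that] by (rule nn_integral_bayes)
  let ?P = "pair_pmf (segment \<nu> 0 n) (segment \<nu> n m)"
  have int: "integrable (measure_pmf ?P) (\<lambda>(u, h). ?M n u * ?M m (u + h))"
    by (rule measure_pmf.integrable_const_bound[where B=1]) (use bd in \<open>auto simp: abs_mult mult_le_one\<close>)
  have int2: "integrable (measure_pmf (segment \<nu> 0 m)) (\<lambda>y. (?M m y)\<^sup>2)"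
    by (rule measure_pmf.integrable_const_bound[where B=1]) (use bd in \<open>auto simp: power_le_one\<close>)
  have "ennreal (\<integral>x. ?M n (x n) * ?M m (x m) \<partial>P) = ennreal (\<integral>(u, h). ?M n u * ?M m (u + h) \<partial>measure_pmf ?P)"
    by (subst integral_two_coordinates[OF assms(2), where f="\<lambda>u y. ?M n u * ?M m y"]) simp
  also have "\<dots> = (\<integral>\<^sup>+ x. ennreal (case x of (u, h) \<Rightarrow> ?M n u * ?M m (u + h)) \<partial>measure_pmf ?P)"
    by (rule nn_integral_eq_integral[symmetric, OF int]) (use bd in auto)
  also have "\<dots> = (\<integral>\<^sup>+ u. ennreal (?M n u) * (\<integral>\<^sup>+ h. ennreal (?M m (u + h)) \<partial>measure_pmf (segment \<nu> n m)) \<partial>measure_pmf (segment \<nu> 0 n))"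
    unfolding nn_integral_pair_pmf' by (simp add: ennreal_mult' bd nn_integral_cmult)
  also have "\<dots> = ennreal (pmf (\<nu> 0) k) * (\<integral>\<^sup>+ h'. \<integral>\<^sup>+ h. ennreal (?M m (k + h' + h)) \<partial>measure_pmf (segment \<nu> n m) \<partial>measure_pmf (segment \<nu> 1 n))"
    by (rule bayes[OF assms(1)])
  also have "(\<integral>\<^sup>+ h'. \<integral>\<^sup>+ h. ennreal (?M m (k + h' + h)) \<partial>measure_pmf (segment \<nu> n m) \<partial>measure_pmf (segment \<nu> 1 n))
      = (\<integral>\<^sup>+ y. ennreal (?M m (k + y)) \<partial>measure_pmf (segment \<nu> 1 m))"
    unfolding segment_append[OF assms] conv_pmf_altdef by (simp add: add.assoc)
  also have "ennreal (pmf (\<nu> 0) k) * \<dots> = (\<integral>\<^sup>+ u. ennreal (?M m u) * ennreal (?M m u) \<partial>measure_pmf (segment \<nu> 0 m))"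
    by (rule bayes[OF m, symmetric])
  also have "\<dots> = (\<integral>\<^sup>+ u. ennreal ((?M m u)\<^sup>2) \<partial>measure_pmf (segment \<nu> 0 m))"
    by (simp add: power2_eq_square ennreal_mult' bd)
  also have "\<dots> = ennreal (\<integral>u. (?M m u)\<^sup>2 \<partial>measure_pmf (segment \<nu> 0 m))"
    by (rule nn_integral_eq_integral[OF int2]) simp
  also have "\<dots> = ennreal (\<integral>x. (?M m (x m))\<^sup>2 \<partial>P)"
    by (subst integral_coordinate[of "\<lambda>y. (?M m y)\<^sup>2"]) simp
  finally show ?thesis
    by (subst (asm) ennreal_inj) (auto intro!: Bochner_Integration.integral_nonneg simp: bd)
qed

lemma posterior_mean:
  assumes "1 \<le> n"
  shows "(\<integral>x. first_step_posterior k n (x n) \<partial>P) = pmf (\<nu> 0) k"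
proof -
  have int: "integrable (measure_pmf (segment \<nu> 0 n)) (first_step_posterior k n)"
    by (rule measure_pmf.integrable_const_bound[where B=1]) (use posterior_bounds[OF assms] in auto)
  have "ennreal (\<integral>x. first_step_posterior k n (x n) \<partial>P) =
      (\<integral>\<^sup>+ u. ennreal (first_step_posterior k n u) * 1 \<partial>measure_pmf (segment \<nu> 0 n))"
    unfolding integral_coordinate[of "first_step_posterior k n"]
    by (subst nn_integral_eq_integral[symmetric, OF int]) (use posterior_bounds[OF assms] in auto)
  also have "\<dots> = ennreal (pmf (\<nu> 0) k)"
    unfolding first_step_posterior_def segment_first[OF assms] by (subst nn_integral_bayes) simp
  finally show ?thesis
    by (subst (asm) ennreal_inj) (auto intro!: Bochner_Integration.integral_nonneg simp: posterior_bounds[OF assms])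
qed

lemma posterior_second_moment:
  assumes triv: "\<And>A. (\<And>n. A \<in> future n) \<Longrightarrow> P.prob A = 0 \<or> P.prob A = 1"
  shows "(\<lambda>n. \<integral>y. (first_step_posterior k n y)\<^sup>2 \<partial>measure_pmf (segment \<nu> 0 n)) \<longlonglongrightarrow> (pmf (\<nu> 0) k)\<^sup>2"
proof (rule LIMSEQ_imp_Suc)
  define G where "G n = sigma (UNIV :: (nat \<Rightarrow> 'g) set)
      (\<Union>i\<in>{Suc n..}. sets (vimage_algebra UNIV (\<lambda>x. x i) (count_space UNIV)))" for n
  have space_G: "space (G n) = space P" and sets_G: "sets (G n) = future (Suc n)" for n
    by (simp_all add: G_def future_def)
  define Z where "Z n x = first_step_posterior k (Suc n) (x (Suc n))" for n and x :: "nat \<Rightarrow> 'g"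
  have "(\<lambda>n. P.expectation (\<lambda>x. (Z n x)\<^sup>2)) \<longlonglongrightarrow> (pmf (\<nu> 0) k)\<^sup>2"
  proof (rule P.reverse_martingale_second_moment[where G=G])
    show "space (G n) = space P" "sets (G n) \<subseteq> sets P" for n
      using future_sets by (auto simp: space_G sets_G)
    show "n \<le> m \<Longrightarrow> sets (G m) \<subseteq> sets (G n)" for n m
      unfolding sets_G by (rule future_antimono) simp
    show "Z n \<in> borel_measurable (G n)" for n
    proof -
      have "(\<lambda>x. x (Suc n)) \<in> G n \<rightarrow>\<^sub>M count_space UNIV"
      proof (rule measurableI)
        fix S :: "'g set"
        have "{x. x (Suc n) \<in> S} \<in> future (Suc n)"
          unfolding future_def coordinate_sets by (rule sigma_sets.Basic) auto
        then show "(\<lambda>x. x (Suc n)) -` S \<inter> space (G n) \<in> sets (G n)"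
          unfolding sets_G space_G by (simp add: vimage_def)
      qed simp
      then show ?thesis
        unfolding Z_def by (rule measurable_compose) simp
    qed
    show "0 \<le> Z n x" "Z n x \<le> 1" for n x
      unfolding Z_def by (rule posterior_bounds, simp)+
    show "P.expectation (Z n) = pmf (\<nu> 0) k" for n
      unfolding Z_def by (rule posterior_mean) simp
    show "n \<le> m \<Longrightarrow> P.expectation (\<lambda>x. Z n x * Z m x) = P.expectation (\<lambda>x. (Z m x)\<^sup>2)" for n m
      unfolding Z_def by (rule posterior_orthogonality) auto
    fix A assume A: "\<And>n. A \<in> sets (G n)"
    have "A \<in> future n" for n
      using A[of n] future_antimono[of n "Suc n"] by (auto simp: sets_G)
    then show "P.prob A = 0 \<or> P.prob A = 1" by (rule triv)
  qed
  then show "(\<lambda>n. \<integral>y. (first_step_posterior k (Suc n) y)\<^sup>2 \<partial>measure_pmf (segment \<nu> 0 (Suc n))) \<longlonglongrightarrow> (pmf (\<nu> 0) k)\<^sup>2"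
    unfolding Z_def integral_coordinate[of "\<lambda>y. (first_step_posterior k (Suc n) y)\<^sup>2" "Suc n" for n] .
qed

text \<open>The information between \<open>x\<^sub>1\<close> and \<open>x\<^sub>n\<close> is bounded by finitely many normalised posterior
  variances, which tend to \<open>0\<close>, plus an entropy tail of the first increment that is small if the
  finite set is large.\<close>

theorem information_vanishes_if_tail_trivial:
  assumes fin: "\<And>i. entropy_pmf (\<nu> i) < top"
    and triv: "\<And>A. (\<And>n. A \<in> future n) \<Longrightarrow> P.prob A = 0 \<or> P.prob A = 1"
  shows "(\<lambda>n. shannon (segment \<nu> 0 n) - shannon (segment \<nu> 1 n)) \<longlonglongrightarrow> 0"
proof (rule LIMSEQ_I)
  fix e :: real assume e: "0 < e"
  let ?a = "\<nu> 0"
  define F where "F N = (from_nat ` {..<N} :: 'g set)" for N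
  have "(\<lambda>N. \<integral>g. indicator (- F N) g * (- ln (pmf ?a g)) \<partial>measure_pmf ?a) \<longlonglongrightarrow> (\<integral>g. 0 \<partial>measure_pmf ?a)"
  proof (rule integral_dominated_convergence[where w="\<lambda>g. - ln (pmf ?a g)"])
    show "AE g in measure_pmf ?a. (\<lambda>N. indicator (- F N) g * (- ln (pmf ?a g))) \<longlonglongrightarrow> 0"
    proof (rule AE_I2)
      fix g :: 'g
      have "g \<in> F N" if "to_nat g < N" for N
        unfolding F_def using that by (intro image_eqI[where x="to_nat g"]) auto
      then have "eventually (\<lambda>N. indicator (- F N) g * (- ln (pmf ?a g)) = 0) sequentially"
        by (intro eventually_sequentiallyI[of "Suc (to_nat g)"]) (simp add: Suc_le_eq)
      then show "(\<lambda>N. indicator (- F N) g * (- ln (pmf ?a g))) \<longlonglongrightarrow> 0"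
        by (rule tendsto_eventually)
    qed
    show "AE g in measure_pmf ?a. norm (indicator (- F N) g * (- ln (pmf ?a g))) \<le> - ln (pmf ?a g)" for N
      by (rule AE_I2) (use surprisal_nonneg[of ?a] in \<open>auto simp: indicator_def\<close>)
    show "integrable (measure_pmf ?a) (\<lambda>g. - ln (pmf ?a g))"
      using integrable_surprisal[OF fin] by simp
  qed auto
  then have "eventually (\<lambda>N. (\<integral>g. indicator (- F N) g * (- ln (pmf ?a g)) \<partial>measure_pmf ?a) < e / 2) sequentially"
    using e by (intro order_tendstoD) auto
  then obtain N where N: "(\<integral>g. indicator (- F N) g * (- ln (pmf ?a g)) \<partial>measure_pmf ?a) < e / 2"
    by (auto simp: eventually_sequentially)
  let ?V = "\<lambda>n. \<Sum>k\<in>F N. (\<integral>y. (first_step_posterior k n y)\<^sup>2 \<partial>measure_pmf (segment \<nu> 0 n)) * inverse (pmf ?a k) - pmf ?a k"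
  have "?V \<longlonglongrightarrow> (\<Sum>k\<in>F N. (pmf ?a k)\<^sup>2 * inverse (pmf ?a k) - pmf ?a k)"
    by (intro tendsto_intros posterior_second_moment triv)
  also have "(\<Sum>k\<in>F N. (pmf ?a k)\<^sup>2 * inverse (pmf ?a k) - pmf ?a k) = 0"
  proof (intro sum.neutral ballI)
    fix k show "(pmf ?a k)\<^sup>2 * inverse (pmf ?a k) - pmf ?a k = 0"
      by (cases "pmf ?a k = 0") (simp_all add: power2_eq_square)
  qed
  finally have "eventually (\<lambda>n. ?V n < e / 2) sequentially"
    using e by (intro order_tendstoD) auto
  then obtain n0 where n0: "\<And>n. n0 \<le> n \<Longrightarrow> ?V n < e / 2"
    by (auto simp: eventually_sequentially)
  have "norm (shannon (segment \<nu> 0 n) - shannon (segment \<nu> 1 n) - 0) < e" if n: "max 1 n0 \<le> n" for n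
  proof -
    have n1: "1 \<le> n" using n by simp
    note seg = segment_first[OF n1]
    note fin1 = entropy_segment_finite[OF fin, where k=1 and n=n]
    have "shannon (segment \<nu> 0 n) - shannon (segment \<nu> 1 n) \<le>
        ?V n + (\<integral>g. indicator (- F N) g * (- ln (pmf ?a g)) \<partial>measure_pmf ?a)"
      using information_le_conditional_variances[OF fin[of 0] fin1, of "F N"]
      unfolding first_step_posterior_def seg divide_inverse by (simp add: F_def)
    also have "\<dots> < e" using N n0[of n] n by simp
    finally have "shannon (segment \<nu> 0 n) - shannon (segment \<nu> 1 n) < e" .
    moreover have "shannon (segment \<nu> 1 n) \<le> shannon (segment \<nu> 0 n)"
      unfolding seg by (rule shannon_conv_ge_right[OF fin fin1])
    ultimately show ?thesis by simp
  qed
  then show "\<exists>no. \<forall>n\<ge>no. norm (shannon (segment \<nu> 0 n) - shannon (segment \<nu> 1 n) - 0) < e"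
    by blast
qed

end

section \<open>Random environments and the asymptotic entropy\<close>

lemma borel_measurable_nn_integral_count_space:
  fixes f :: "'w \<Rightarrow> 'g :: countable \<Rightarrow> ennreal"
  assumes "\<And>g. (\<lambda>w. f w g) \<in> borel_measurable M"
  shows "(\<lambda>w. \<integral>\<^sup>+ g. f w g \<partial>count_space UNIV) \<in> borel_measurable M"
proof -
  interpret sigma_finite_measure "count_space (UNIV :: 'g set)"
    by (rule sigma_finite_measure_count_space)
  have "(\<lambda>x. f (fst x) (snd x)) \<in> borel_measurable (M \<Otimes>\<^sub>M count_space UNIV)"
    by (rule measurable_compose_countable[where g=snd]) (use measurable_compose[OF measurable_fst assms] in auto)
  then show ?thesis
    by (intro borel_measurable_nn_integral) (simp add: split_beta')
qed

lemma measurable_entropy_pmf: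
  fixes p :: "'w \<Rightarrow> 'g :: countable pmf"
  assumes [measurable]: "\<And>g. (\<lambda>w. pmf (p w) g) \<in> borel_measurable M"
  shows "(\<lambda>w. entropy_pmf (p w)) \<in> borel_measurable M"
  unfolding entropy_pmf_def by (rule borel_measurable_nn_integral_count_space) measurable

lemma measurable_conv_pmf:
  fixes p q :: "'w \<Rightarrow> 'g :: {group_add, countable} pmf"
  assumes [measurable]: "\<And>g. (\<lambda>w. pmf (p w) g) \<in> borel_measurable M" "\<And>g. (\<lambda>w. pmf (q w) g) \<in> borel_measurable M"
  shows "(\<lambda>w. pmf (conv_pmf (p w) (q w)) g) \<in> borel_measurable M"
proof -
  have "(\<lambda>w. ennreal (pmf (conv_pmf (p w) (q w)) g)) \<in> borel_measurable M"
    unfolding pmf_conv by (rule borel_measurable_nn_integral_count_space) measurable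
  then have "(\<lambda>w. enn2real (ennreal (pmf (conv_pmf (p w) (q w)) g))) \<in> borel_measurable M"
    by (rule borel_measurable_enn2real)
  then show ?thesis by simp
qed

locale random_environment = ergodic_map M T for M :: "'w measure" and T +
  fixes \<mu> :: "'w \<Rightarrow> 'g :: {group_add, countable} pmf"
  assumes \<mu>_measurable: "(\<lambda>\<omega>. measure_pmf (\<mu> \<omega>)) \<in> M \<rightarrow>\<^sub>M prob_algebra (count_space UNIV)"
    and mean_entropy_finite: "mean_entropy M \<mu> < top"
begin

text \<open>For \<open>\<omega>\<close> in the base this is the sequence of increment laws that the walk meets; all walks
  along one orbit read the same sequence from different starting times.\<close>

definition env :: "'w \<Rightarrow> nat \<Rightarrow> 'g pmf" where
  "env \<omega> i = \<mu> ((T ^^ i) \<omega>)"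

lemma env_shift: "env ((T ^^ j) \<omega>) i = env \<omega> (i + j)"
  by (simp add: env_def funpow_add)

lemma segment_shift: "segment (env ((T ^^ j) \<omega>)) k n = segment (env \<omega>) (k + j) (n + j)"
proof -
  have "map (env ((T ^^ j) \<omega>)) [k..<n] = map (env \<omega>) (map (\<lambda>i. i + j) [k..<n])"
    by (simp add: env_shift)
  also have "map (\<lambda>i. i + j) [k..<n] = [k + j..<n + j]"
    by (rule nth_equalityI) auto
  finally show ?thesis by (simp add: segment_def)
qed

lemma pmf_\<mu>_measurable: "(\<lambda>\<omega>. pmf (\<mu> \<omega>) g) \<in> borel_measurable M"
proof -
  have "(\<lambda>\<omega>. measure (measure_pmf (\<mu> \<omega>)) {g}) \<in> borel_measurable M"
    by (rule measurable_compose[OF measurable_prob_algebraD[OF \<mu>_measurable] measurable_measure_subprob_algebra]) simp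
  then show ?thesis by (simp add: measure_pmf_single)
qed

lemma pmf_segment_measurable: "(\<lambda>\<omega>. pmf (segment (env \<omega>) k n) g) \<in> borel_measurable M"
proof (cases "k \<le> n")
  case True
  then show ?thesis
  proof (induction n arbitrary: g rule: dec_induct)
    case (step n)
    have "(\<lambda>\<omega>. pmf (env \<omega> n) g) \<in> borel_measurable M" for g
      unfolding env_def by (rule measurable_compose[OF T_power_measurable pmf_\<mu>_measurable])
    with step show ?case by (simp add: segment_Suc measurable_conv_pmf)
  qed simp
next
  case False
  then show ?thesis by (simp add: segment_def)
qed

definition block_entropy :: "nat \<Rightarrow> 'w \<Rightarrow> real" where
  "block_entropy n \<omega> = shannon (segment (env \<omega>) 0 n)"

text \<open>The mutual information between \<open>x\<^sub>1\<close> and \<open>x\<^sub>n\<close>.\<close>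

definition step_information :: "nat \<Rightarrow> 'w \<Rightarrow> real" where
  "step_information n \<omega> = shannon (segment (env \<omega>) 0 n) - shannon (segment (env \<omega>) 1 n)"

definition limit_information :: "'w \<Rightarrow> real" where
  "limit_information \<omega> = lim (\<lambda>n. step_information n \<omega>)"

lemma shannon_segment_measurable [measurable]: "(\<lambda>\<omega>. shannon (segment (env \<omega>) k n)) \<in> borel_measurable M"
  unfolding shannon_eq_enn2real
  by (intro borel_measurable_enn2real measurable_entropy_pmf pmf_segment_measurable)

lemma block_entropy_measurable [measurable]: "block_entropy n \<in> borel_measurable M"
  unfolding block_entropy_def[abs_def] by measurable

lemma step_information_measurable [measurable]: "step_information n \<in> borel_measurable M"
  unfolding step_information_def[abs_def] by measurable

lemma limit_information_measurable [measurable]: "limit_information \<in> borel_measurable M"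
  unfolding limit_information_def[abs_def] by measurable

text \<open>Along the orbit, the terms that telescope are again values of the information function.\<close>

lemma information_shift:
  assumes "j \<le> n"
  shows "shannon (segment (env \<omega>) j n) - shannon (segment (env \<omega>) (Suc j) n) = step_information (n - j) ((T ^^ j) \<omega>)"
  using assms unfolding step_information_def segment_shift by simp

lemma AE_entropy_finite: "AE \<omega> in M. \<forall>i. entropy_pmf (env \<omega> i) < top"
proof -
  have "AE \<omega> in M. entropy_pmf (\<mu> \<omega>) \<noteq> top"
    using mean_entropy_finite unfolding mean_entropy_def
    by (intro nn_integral_PInf_AE[unfolded infinity_ennreal_def] measurable_entropy_pmf pmf_\<mu>_measurable) auto
  from AE_all_T_power[OF this] show ?thesis
    by (simp add: env_def less_top)
qed

lemma step_information_1: "step_information 1 \<omega> = shannon (\<mu> \<omega>)"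
  by (simp add: step_information_def segment_Suc_left env_def)

context
  fixes \<omega> assumes fin: "\<forall>i. entropy_pmf (env \<omega> i) < top"
begin

lemma segment_entropy_finite: "entropy_pmf (segment (env \<omega>) k n) < top"
  by (rule entropy_segment_finite) (use fin in blast)

lemma step_information_nonneg: "1 \<le> n \<Longrightarrow> 0 \<le> step_information n \<omega>"
  unfolding step_information_def
  using segment_Suc_left[of 0 n "env \<omega>"] shannon_conv_ge_right[OF fin[rule_format, of 0] segment_entropy_finite[of 1 n]]
  by simp

lemma step_information_Suc: "1 \<le> n \<Longrightarrow> step_information (Suc n) \<omega> \<le> step_information n \<omega>"
proof -
  assume n: "1 \<le> n"
  have "segment (env \<omega>) 0 n = conv_pmf (env \<omega> 0) (segment (env \<omega>) 1 n)"
    using n segment_Suc_left[of 0 n "env \<omega>"] by simp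
  moreover have "segment (env \<omega>) 1 (Suc n) = conv_pmf (segment (env \<omega>) 1 n) (env \<omega> n)"
    using n by (rule segment_Suc)
  moreover have "segment (env \<omega>) 0 (Suc n) = conv_pmf (env \<omega> 0) (conv_pmf (segment (env \<omega>) 1 n) (env \<omega> n))"
    using calculation(2) segment_Suc_left[of 0 "Suc n" "env \<omega>"] by simp
  ultimately show ?thesis
    using shannon_conv_submodular[OF fin[rule_format, of 0] segment_entropy_finite[of 1 n] fin[rule_format, of n]]
    by (simp add: step_information_def)
qed

lemma step_information_antimono:
  assumes "1 \<le> n" "n \<le> m"
  shows "step_information m \<omega> \<le> step_information n \<omega>"
  using assms(2)
proof (induction m rule: dec_induct)
  case (step m)
  with step_information_Suc[of m] assms(1) show ?case by simp
qed simp

lemma step_information_tendsto: "(\<lambda>n. step_information n \<omega>) \<longlonglongrightarrow> limit_information \<omega>"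
proof -
  have "decseq (\<lambda>n. step_information (Suc n) \<omega>)"
    by (simp add: decseq_Suc_iff step_information_Suc)
  moreover have "0 \<le> step_information (Suc n) \<omega>" for n
    by (rule step_information_nonneg) simp
  ultimately obtain L where "(\<lambda>n. step_information (Suc n) \<omega>) \<longlonglongrightarrow> L"
    using decseq_convergent[of "\<lambda>n. step_information (Suc n) \<omega>" 0] by blast
  then have "(\<lambda>n. step_information n \<omega>) \<longlonglongrightarrow> L"
    by (rule LIMSEQ_imp_Suc)
  then have "convergent (\<lambda>n. step_information n \<omega>)"
    by (rule convergentI)
  then show ?thesis
    unfolding limit_information_def by (simp add: convergent_LIMSEQ_iff)
qed

lemma limit_information_bounds:
  shows "0 \<le> limit_information \<omega>" and "1 \<le> n \<Longrightarrow> limit_information \<omega> \<le> step_information n \<omega>"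
proof -
  show "0 \<le> limit_information \<omega>"
    using step_information_tendsto by (rule LIMSEQ_le_const) (use step_information_nonneg in blast)
  show "1 \<le> n \<Longrightarrow> limit_information \<omega> \<le> step_information n \<omega>"
    using step_information_tendsto by (rule LIMSEQ_le_const2) (use step_information_antimono in blast)
qed

lemma information_vanishes_along_orbit:
  "(\<lambda>n. shannon (segment (env \<omega>) 0 n) - shannon (segment (env \<omega>) k n)) \<longlonglongrightarrow> 0"
  if "\<forall>j. limit_information ((T ^^ j) \<omega>) = 0" "\<forall>j. (\<lambda>n. step_information n ((T ^^ j) \<omega>)) \<longlonglongrightarrow> limit_information ((T ^^ j) \<omega>)"
proof (induction k)
  case (Suc k)
  have "(\<lambda>n. shannon (segment (env \<omega>) k (n + k)) - shannon (segment (env \<omega>) (Suc k) (n + k))) \<longlonglongrightarrow> 0"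
    using that[rule_format, of k] by (simp add: information_shift)
  then have "(\<lambda>n. shannon (segment (env \<omega>) k n) - shannon (segment (env \<omega>) (Suc k) n)) \<longlonglongrightarrow> 0"
    by (rule LIMSEQ_offset)
  from tendsto_add[OF Suc.IH this] show ?case by simp
qed simp

end

text \<open>The chain rule for entropy, written along the orbit. Keeping a final block of fixed length \<open>N\<close>
  ensures that every information term has time horizon at least \<open>N\<close>.\<close>

lemma block_entropy_decomposition:
  "block_entropy (n + N) \<omega> = (\<Sum>i<n. step_information (n + N - i) ((T ^^ i) \<omega>)) + block_entropy N ((T ^^ n) \<omega>)"
proof -
  have "(\<Sum>i<n. step_information (n + N - i) ((T ^^ i) \<omega>)) =
      (\<Sum>i<n. shannon (segment (env \<omega>) i (n + N)) - shannon (segment (env \<omega>) (Suc i) (n + N)))"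
    by (intro sum.cong refl information_shift[symmetric]) simp
  also have "\<dots> = shannon (segment (env \<omega>) 0 (n + N)) - shannon (segment (env \<omega>) n (n + N))"
    by (rule sum_lessThan_telescope'[of "\<lambda>i. shannon (segment (env \<omega>) i (n + N))"])
  finally show ?thesis
    unfolding block_entropy_def segment_shift by (simp add: add.commute)
qed

lemma entropy_finite_shift: "\<forall>i. entropy_pmf (env \<omega> i) < top \<Longrightarrow> \<forall>i. entropy_pmf (env ((T ^^ j) \<omega>) i) < top"
  by (simp add: env_shift)

lemma integrable_shannon: "integrable M (\<lambda>\<omega>. shannon (\<mu> \<omega>))"
proof (rule integrableI_nonneg)
  show "(\<lambda>\<omega>. shannon (\<mu> \<omega>)) \<in> borel_measurable M"
    unfolding shannon_eq_enn2real by (intro borel_measurable_enn2real measurable_entropy_pmf pmf_\<mu>_measurable)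
  have le: "ennreal (enn2real x) \<le> x" for x
    by (cases x rule: ennreal_cases) auto
  have "(\<integral>\<^sup>+ \<omega>. ennreal (shannon (\<mu> \<omega>)) \<partial>M) \<le> mean_entropy M \<mu>"
    unfolding mean_entropy_def shannon_eq_enn2real by (intro nn_integral_mono le)
  then show "(\<integral>\<^sup>+ \<omega>. ennreal (shannon (\<mu> \<omega>)) \<partial>M) < \<infinity>"
    using mean_entropy_finite by simp
qed (simp add: shannon_nonneg)

lemma integrable_step_information: "1 \<le> n \<Longrightarrow> integrable M (step_information n)"
proof (rule Bochner_Integration.integrable_bound[OF integrable_shannon])
  assume n: "1 \<le> n"
  show "AE \<omega> in M. norm (step_information n \<omega>) \<le> norm (shannon (\<mu> \<omega>))"
    using AE_entropy_finite
  proof eventually_elim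
    case (elim \<omega>)
    with step_information_nonneg[OF elim n] step_information_antimono[OF elim order_refl n] show ?case
      by (simp add: step_information_1[symmetric])
  qed
qed simp

lemma integrable_limit_information: "integrable M limit_information"
proof (rule Bochner_Integration.integrable_bound[OF integrable_shannon])
  show "AE \<omega> in M. norm (limit_information \<omega>) \<le> norm (shannon (\<mu> \<omega>))"
    using AE_entropy_finite
  proof eventually_elim
    case (elim \<omega>)
    with limit_information_bounds(1)[OF elim] limit_information_bounds(2)[OF elim, of 1] show ?case
      by (simp add: step_information_1[symmetric])
  qed
qed simp

lemma integrable_block_entropy: "integrable M (block_entropy N)"
proof (induction N)
  case 0
  show ?case by (simp add: block_entropy_def[abs_def])
next
  case (Suc N)
  have eq: "block_entropy (Suc N) = (\<lambda>\<omega>. step_information (Suc N) \<omega> + block_entropy N (T \<omega>))"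
    using block_entropy_decomposition[of 1 N] by (auto simp: fun_eq_iff)
  show ?case
    unfolding eq by (intro Bochner_Integration.integrable_add integrable_step_information integrable_T Suc) simp
qed

lemma step_information_mean_tendsto:
  "(\<lambda>n. \<integral>\<omega>. step_information n \<omega> \<partial>M) \<longlonglongrightarrow> (\<integral>\<omega>. limit_information \<omega> \<partial>M)"
proof (rule LIMSEQ_imp_Suc, rule integral_dominated_convergence[where w="\<lambda>\<omega>. shannon (\<mu> \<omega>)"])
  show "AE \<omega> in M. (\<lambda>n. step_information (Suc n) \<omega>) \<longlonglongrightarrow> limit_information \<omega>"
    using AE_entropy_finite by eventually_elim (intro LIMSEQ_Suc step_information_tendsto)
  show "AE \<omega> in M. norm (step_information (Suc n) \<omega>) \<le> shannon (\<mu> \<omega>)" for n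
    using AE_entropy_finite
  proof eventually_elim
    case (elim \<omega>)
    with step_information_nonneg[OF elim, of "Suc n"] step_information_antimono[OF elim order_refl, of "Suc n"] show ?case
      by (simp add: step_information_1[symmetric])
  qed
qed (simp_all add: integrable_shannon)

text \<open>The decomposition with \<open>N = 0\<close> bounds the entropy below by a Birkhoff sum of the limit
  information, and the one with large \<open>N\<close> bounds it above by a Birkhoff sum of the information at
  horizon \<open>N\<close>, up to a sublinear term. The two means agree in the limit \<open>N \<longlongrightarrow> \<infinity>\<close>.\<close>

theorem block_entropy_rate:
  "AE \<omega> in M. (\<lambda>n. block_entropy n \<omega> / n) \<longlonglongrightarrow> (\<integral>\<omega>. limit_information \<omega> \<partial>M)"
proof -
  let ?h = "\<integral>\<omega>. limit_information \<omega> \<partial>M"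
  have "AE \<omega> in M. \<forall>N. (\<lambda>n. birkhoff_sum (step_information (Suc N)) n \<omega> / n) \<longlonglongrightarrow> (\<integral>\<omega>. step_information (Suc N) \<omega> \<partial>M)"
    using birkhoff_ergodic[OF integrable_step_information[of "Suc N" for N]] unfolding AE_all_countable by simp
  moreover have "AE \<omega> in M. \<forall>N. (\<lambda>n. block_entropy (Suc N) ((T ^^ n) \<omega>) / n) \<longlonglongrightarrow> 0"
    using orbit_growth_sublinear[OF integrable_block_entropy] unfolding AE_all_countable by simp
  moreover note birkhoff_ergodic[OF integrable_limit_information] AE_entropy_finite
  ultimately show ?thesis
  proof eventually_elim
    case (elim \<omega>)
    note fin = entropy_finite_shift[OF elim(4)]
    show ?case
    proof (rule order_tendstoI)
      fix l assume "l < ?h"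
      with elim(3) have "eventually (\<lambda>n. l < birkhoff_sum limit_information n \<omega> / n) sequentially"
        by (rule order_tendstoD)
      then show "eventually (\<lambda>n. l < block_entropy n \<omega> / n) sequentially"
      proof eventually_elim
        case (elim n)
        have "birkhoff_sum limit_information n \<omega> \<le> (\<Sum>i<n. step_information (n - i) ((T ^^ i) \<omega>))"
          unfolding birkhoff_sum_def by (intro sum_mono limit_information_bounds(2)[OF fin]) auto
        also have "\<dots> = block_entropy n \<omega>"
          using block_entropy_decomposition[of n 0 \<omega>] by (simp add: block_entropy_def)
        finally show ?case using elim by (meson divide_right_mono less_le_trans of_nat_0_le_iff)
      qed
    next
      fix u assume "?h < u"
      then have "eventually (\<lambda>n. (\<integral>\<omega>. step_information n \<omega> \<partial>M) < u) sequentially"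
        by (intro order_tendstoD[OF step_information_mean_tendsto])
      \<comment> \<open>The horizon is \<open>Suc N\<close> because the information decreases only from horizon \<open>1\<close> on.\<close>
      then obtain N where N: "(\<integral>\<omega>. step_information (Suc N) \<omega> \<partial>M) < u"
        unfolding eventually_sequentially by (meson le_SucI order_refl)
      have "(\<lambda>n. birkhoff_sum (step_information (Suc N)) n \<omega> / n + block_entropy (Suc N) ((T ^^ n) \<omega>) / n)
          \<longlonglongrightarrow> (\<integral>\<omega>. step_information (Suc N) \<omega> \<partial>M) + 0"
        using elim by (intro tendsto_add) auto
      then have "eventually (\<lambda>n. birkhoff_sum (step_information (Suc N)) n \<omega> / n + block_entropy (Suc N) ((T ^^ n) \<omega>) / n < u) sequentially"
        by (rule order_tendstoD) (use N in simp)
      then have "eventually (\<lambda>n. block_entropy (n + Suc N) \<omega> / real (n + Suc N) < u) sequentially"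
        using eventually_gt_at_top[of 0]
      proof eventually_elim
        case (elim n)
        have "block_entropy (n + Suc N) \<omega> \<le> birkhoff_sum (step_information (Suc N)) n \<omega> + block_entropy (Suc N) ((T ^^ n) \<omega>)"
          unfolding block_entropy_decomposition birkhoff_sum_def
          by (intro add_right_mono sum_mono step_information_antimono[OF fin]) auto
        then have "block_entropy (n + Suc N) \<omega> / n \<le> (birkhoff_sum (step_information (Suc N)) n \<omega> + block_entropy (Suc N) ((T ^^ n) \<omega>)) / n"
          by (rule divide_right_mono) simp
        moreover have "block_entropy (n + Suc N) \<omega> / real (n + Suc N) \<le> block_entropy (n + Suc N) \<omega> / n"
          using elim by (intro divide_left_mono) (auto simp: block_entropy_def shannon_nonneg)
        ultimately show ?case using elim by (simp add: add_divide_distrib)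
      qed
      then show "eventually (\<lambda>n. block_entropy n \<omega> / n < u) sequentially"
        by (rule eventually_sequentially_seg[THEN iffD1])
    qed
  qed
qed

lemma conv_segment_eq: "1 \<le> n \<Longrightarrow> conv_segment T \<mu> 0 (n - 1) \<omega> = segment (env \<omega>) 0 n"
  by (simp add: conv_segment_def segment_def env_def[abs_def])

lemma AE_limit_information_nonneg: "AE \<omega> in M. 0 \<le> limit_information \<omega>"
  using AE_entropy_finite by eventually_elim (rule limit_information_bounds)

lemma limit_information_mean_nonneg: "0 \<le> (\<integral>\<omega>. limit_information \<omega> \<partial>M)"
  using AE_limit_information_nonneg by (rule integral_nonneg_AE)

theorem asymptotic_entropy_eq: "asymptotic_entropy M T \<mu> = ennreal (\<integral>\<omega>. limit_information \<omega> \<partial>M)"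
proof (rule asymptotic_entropy_eqI)
  show "prob_space M" by (rule prob_space_axioms)
  show "AE \<omega> in M. (\<lambda>n. entropy_pmf (conv_segment T \<mu> 0 (n - 1) \<omega>) / of_nat n) \<longlonglongrightarrow> ennreal (\<integral>\<omega>. limit_information \<omega> \<partial>M)"
    using block_entropy_rate AE_entropy_finite
  proof eventually_elim
    case (elim \<omega>)
    have eq: "entropy_pmf (conv_segment T \<mu> 0 (n - 1) \<omega>) / of_nat n = ennreal (block_entropy n \<omega> / n)" if "1 \<le> n" for n
    proof -
      have "entropy_pmf (segment (env \<omega>) 0 n) = ennreal (block_entropy n \<omega>)"
        unfolding block_entropy_def
        by (rule entropy_pmf_eq_shannon[OF entropy_segment_finite]) (use elim(2) in simp)
      then show ?thesis
        unfolding conv_segment_eq[OF that]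
        using that by (simp add: divide_ennreal block_entropy_def shannon_nonneg ennreal_of_nat_eq_real_of_nat)
    qed
    have "(\<lambda>n. ennreal (block_entropy n \<omega> / n)) \<longlonglongrightarrow> ennreal (\<integral>\<omega>. limit_information \<omega> \<partial>M)"
      using elim(1) by (rule tendsto_ennrealI)
    then show ?case
      by (rule Lim_transform_eventually) (rule eventually_sequentiallyI[of 1], simp only: eq)
  qed
qed

lemma trivial_tail_boundary_iff:
  "trivial_tail_boundary T \<mu> \<omega> \<longleftrightarrow>
    (\<forall>A. (\<forall>n. A \<in> markov_path.future n) \<longrightarrow>
      measure (markov_path.P 0 (\<lambda>n g. map_pmf ((+) g) (env \<omega> n))) A = 0 \<or>
      measure (markov_path.P 0 (\<lambda>n g. map_pmf ((+) g) (env \<omega> n))) A = 1)"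
proof -
  interpret W: increment_walk "env \<omega>" .
  have "rwtdi_measure T \<mu> \<omega> = W.P"
    by (simp add: rwtdi_measure_def markov_path.P_def rwtdi_transition_def[abs_def] env_def)
  then show ?thesis
    unfolding trivial_tail_boundary_def by (simp add: W.tail_events_iff Ball_def)
qed

text \<open>The rate is the integral of the nonnegative limit information, so it vanishes iff the limit
  information does almost everywhere, and then it vanishes along almost every whole orbit, which
  is what independence from every \<open>x\<^sub>k\<close> requires. In the other direction \<open>k = 1\<close> is enough.\<close>

theorem entropy_zero_iff_tail_trivial:
  "asymptotic_entropy M T \<mu> = 0 \<longleftrightarrow> (AE \<omega> in M. trivial_tail_boundary T \<mu> \<omega>)"
proof -
  have "asymptotic_entropy M T \<mu> = 0 \<longleftrightarrow> (\<integral>\<omega>. limit_information \<omega> \<partial>M) = 0"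
    using limit_information_mean_nonneg by (auto simp: asymptotic_entropy_eq ennreal_eq_0_iff)
  also have "\<dots> \<longleftrightarrow> (AE \<omega> in M. limit_information \<omega> = 0)"
    by (rule integral_nonneg_eq_0_iff_AE[OF integrable_limit_information AE_limit_information_nonneg])
  also have "\<dots> \<longleftrightarrow> (AE \<omega> in M. trivial_tail_boundary T \<mu> \<omega>)"
  proof
    assume "AE \<omega> in M. limit_information \<omega> = 0"
    then have "AE \<omega> in M. \<forall>j. limit_information ((T ^^ j) \<omega>) = 0" by (rule AE_all_T_power)
    then show "AE \<omega> in M. trivial_tail_boundary T \<mu> \<omega>"
      using AE_entropy_finite
    proof eventually_elim
      case (elim \<omega>)
      interpret W: increment_walk "env \<omega>" .
      have "W.P.prob A = 0 \<or> W.P.prob A = 1" if "\<And>n. A \<in> W.future n" for A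
      proof (rule W.tail_trivial_if_information_vanishes[OF _ _ that])
        show "entropy_pmf (env \<omega> i) < top" for i using elim(2) by blast
        show "(\<lambda>n. shannon (segment (env \<omega>) 0 n) - shannon (segment (env \<omega>) k n)) \<longlonglongrightarrow> 0" for k
          using elim(1) by (rule information_vanishes_along_orbit[OF elim(2)])
            (intro allI step_information_tendsto entropy_finite_shift elim(2))
      qed
      then show ?case unfolding trivial_tail_boundary_iff by blast
    qed
  next
    assume "AE \<omega> in M. trivial_tail_boundary T \<mu> \<omega>"
    then show "AE \<omega> in M. limit_information \<omega> = 0"
      using AE_entropy_finite
    proof eventually_elim
      case (elim \<omega>)
      interpret W: increment_walk "env \<omega>" .
      have "(\<lambda>n. step_information n \<omega>) \<longlonglongrightarrow> 0"
        unfolding step_information_def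
        by (rule W.information_vanishes_if_tail_trivial) (use elim in \<open>auto simp: trivial_tail_boundary_iff\<close>)
      with step_information_tendsto[OF elim(2)] show ?case by (rule LIMSEQ_unique)
    qed
  qed
  finally show ?thesis .
qed

end

theorem theorem3p9:
  fixes M :: "'w measure"
    and T :: "'w \<Rightarrow> 'w"
    and \<mu> :: "'w \<Rightarrow> 'g::{group_add, countable} pmf"
  assumes "lebesgue_prob_space M"
    and "invertible_measure_preserving M T"
    and "ergodic M T"
    and "(\<lambda>\<omega>. measure_pmf (\<mu> \<omega>)) \<in> M \<rightarrow>\<^sub>M prob_algebra (count_space UNIV)"
    and "mean_entropy M \<mu> < \<infinity>"
  shows "asymptotic_entropy M T \<mu> = 0 \<longleftrightarrow> (AE \<omega> in M. trivial_tail_boundary T \<mu> \<omega>)"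
proof -
  interpret prob_space M using assms(1) by (simp add: lebesgue_prob_space_def)
  interpret random_environment M T \<mu>
    by unfold_locales (use assms in \<open>auto simp: invertible_measure_preserving_def\<close>)
  show ?thesis by (rule entropy_zero_iff_tail_trivial)
qed

end
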